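(* Assume the conditions (A$_0$) listed in the context and fix $(t_0,x,y)\in[0,T]\times\mathbb{R}^d\times\mathbb{R}$. For $\varepsilon>0$ let $\bar\alpha^\varepsilon\in\mathcal{A}$ be an optimal strategy for the regularised problem, i.e. $v^{\varepsilon,\bar\alpha^\varepsilon}(t_0,x,y)=v^\varepsilon(t_0,x,y)$, or, if the supremum is not attained, let $\tilde\alpha^\varepsilon\in\mathcal{A}$ be a $\kappa$-optimal strategy for the same problem ($\kappa>0$), i.e. $v^\varepsilon(t_0,x,y)\le v^{\varepsilon,\tilde\alpha^\varepsilon}(t_0,x,y)+\kappa$. Then the same strategy is $\delta$-optimal for the original degenerate problem, i.e. $$v(t_0,x,y)\le v^{\alpha}(t_0,x,y)+\delta\qquad\text{with }\alpha=\bar\alpha^\varepsilon\text{ (respectively }\alpha=\tilde\alpha^\varepsilon),$$ with an appropriate choice of the constant $\delta=\delta(\varepsilon,\kappa)$ such that $\delta\to0$ as $\varepsilon,\kappa\to0$ (with $\kappa=0$ when an optimal strategy is used). Consequently there exists a nearly optimal strategy for the original problem, i.e. a $\delta$-optimal strategy can be found for every $\delta>0$ (in this way).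
   Context: Setting. $T>0$ and $\theta\in\mathbb{R}$ are fixed, $A\subset\mathbb{R}^\ell$ is a compact convex set, $(\Omega,\mathcal{F},\mathbb{P},(\mathcal{F}_t))$ is a filtered probability space carrying a $d$-dimensional Wiener process $W$ and an independent one-dimensional Wiener process $\tilde W$, the pair $(W,\tilde W)$ being an $(\mathcal{F}_t)$-Wiener process. $\mathcal{A}$ is the class of progressively measurable $A$-valued processes (strategies). For $\alpha\in\mathcal{A}$, $\varepsilon>0$ and $(t_0,x,y)\in[0,T]\times\mathbb{R}^d\times\mathbb{R}$, the processes $X$ ($\mathbb{R}^d$-valued) and $Y,Y^\varepsilon$ (real-valued) solve on $[t_0,T]$ $$dX_t=b(\alpha_t,t,X_t)\,dt+\sigma(\alpha_t,t,X_t)\,dW_t,\ X_{t_0}=x;\quad dY_t=f(\alpha_t,t,X_t)\,dt,\ Y_{t_0}=y;\quad dY^\varepsilon_t=f(\alpha_t,t,X_t)\,dt+\varepsilon\,d\tilde W_t,\ Y^\varepsilon_{t_0}=y,$$ where $b$ is $\mathbb{R}^d$-valued, $\sigma$ is $d\times d$-matrix-valued and $f$ is real-valued, all defined on $A\times[0,T]\times\mathbb{R}^d$. $E^\alpha_{t_0,x,y}$, $\mathrm{Var}^\alpha_{t_0,x,y}$ denote expectation and variance for these controlled processes. $\Phi:\mathbb{R}^d\to\mathbb{R}$ and $g(x,y)=y+\Phi(x)$. Mean-variance functionals and value functions: $$v^\alpha(t_0,x,y)=E^\alpha_{t_0,x,y}g(X_T,Y_T)-\theta\,\mathrm{Var}^\alpha_{t_0,x,y}\,g(X_T,Y_T),\qquad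 v^{\varepsilon,\alpha}(t_0,x,y)=E^\alpha_{t_0,x,y}g(X_T,Y^\varepsilon_T)-\theta\,\mathrm{Var}^\alpha_{t_0,x,y}\,g(X_T,Y^\varepsilon_T),$$ $$v(t_0,x,y)=\sup_{\alpha\in\mathcal{A}}v^\alpha(t_0,x,y),\qquad v^\varepsilon(t_0,x,y)=\sup_{\alpha\in\mathcal{A}}v^{\varepsilon,\alpha}(t_0,x,y).$$ Conditions (A$_0$): (1) $\sigma,b,f$ are Borel with respect to $(a,t,x)$, continuous with respect to $(a,x)$ for every $t$, and continuous with respect to $x$ uniformly over $a\in A$ for each $t$; $\Phi$ is continuous. (2) There are constants $K,K_1,K_2$ such that for all $a\in A$, $t_1,t_2\in[0,T]$, $x,z\in\mathbb{R}^d$: $\|\sigma(a,t_1,x)-\sigma(a,t_2,z)\|\le K_1(\|x-z\|+|t_1-t_2|)$, $\|b(a,t_1,x)-b(a,t_2,z)\|\le K_1(\|x-z\|+|t_1-t_2|)$, $|f(a,t_1,x)-f(a,t_2,z)|\le K_2(\|x-z\|+|t_1-t_2|)$. (3) $\|\sigma(a,t,x)\|+\|b(a,t,x)\|\le K$ and $|f(a,t,x)|\le K_2$. (4) $|\Phi(x)|\le K_2(1+\|x\|^m)$ for some fixed $m$. (5) $\sigma\sigma^T$ is uniformly non-degenerate. *)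

theory Defs
  imports "HOL-Probability.Probability"
begin

section \<open>Filtered probability spaces and Wiener processes\<close>

text \<open>Time is the half-line \<open>{0..}\<close>; the values of \<open>F\<close> and of all processes at negative
  times are irrelevant.\<close>

locale filtered_prob_space = prob_space M for M :: "'w measure" +
  fixes F :: "real \<Rightarrow> 'w measure"
  assumes subalgebra_F: "0 \<le> t \<Longrightarrow> subalgebra M (F t)"
    and F_mono: "0 \<le> s \<Longrightarrow> s \<le> t \<Longrightarrow> sets (F s) \<subseteq> sets (F t)"

definition progressively_measurable_on ::
  "real set \<Rightarrow> (real \<Rightarrow> 'w measure) \<Rightarrow> (real \<Rightarrow> 'w \<Rightarrow> 'b::topological_space) \<Rightarrow> bool" where
  "progressively_measurable_on S F Z \<longleftrightarrow>
     (\<forall>t\<in>S. (\<lambda>(s, \<omega>). Z s \<omega>) \<in> borel_measurable (restrict_space borel (S \<inter> {..t}) \<Otimes>\<^sub>M F t))"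

text \<open>The increment over \<open>[s, t]\<close> is independent of \<open>F s\<close> and has law \<open>N(0, (t - s) I)\<close>,
  written through its independent coordinates. For a Wiener process in \<open>real ^ 'n \<times> real\<close> the
  two components are therefore independent of each other.\<close>

definition wiener_process ::
  "'w measure \<Rightarrow> (real \<Rightarrow> 'w measure) \<Rightarrow> (real \<Rightarrow> 'w \<Rightarrow> 'b::euclidean_space) \<Rightarrow> bool" where
  "wiener_process M F B \<longleftrightarrow>
     (\<forall>t\<ge>0. B t \<in> borel_measurable (F t)) \<and>
     (AE \<omega> in M. B 0 \<omega> = 0) \<and>
     (AE \<omega> in M. continuous_on {0..} (\<lambda>t. B t \<omega>)) \<and>
     (\<forall>s t. 0 \<le> s \<and> s < t \<longrightarrow>
        prob_space.indep_set M (sets (F s))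
          (sets (vimage_algebra (space M) (\<lambda>\<omega>. B t \<omega> - B s \<omega>) borel)) \<and>
        prob_space.indep_vars M (\<lambda>_. borel) (\<lambda>i \<omega>. (B t \<omega> - B s \<omega>) \<bullet> i) Basis \<and>
        (\<forall>i\<in>Basis. distributed M lborel (\<lambda>\<omega>. (B t \<omega> - B s \<omega>) \<bullet> i)
                     (normal_density 0 (sqrt (t - s)))))"


section \<open>The Ito integral\<close>

text \<open>A simple integrand on \<open>[a, b]\<close> is given by a partition \<open>a = s 0 < \<dots> < s n = b\<close> and bounded
  \<open>F (s i)\<close>-measurable values \<open>\<xi> i\<close>, taken on \<open>{s i<..s (Suc i)}\<close>.\<close>

definition simple_integrand ::
  "(real \<Rightarrow> 'w measure) \<Rightarrow> real \<Rightarrow> real \<Rightarrow> nat \<Rightarrow> (nat \<Rightarrow> real) \<Rightarrow>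
   (nat \<Rightarrow> 'w \<Rightarrow> real ^ 'n ^ 'm) \<Rightarrow> bool" where
  "simple_integrand F a b n s \<xi> \<longleftrightarrow>
     s 0 = a \<and> s n = b \<and>
     (\<forall>i<n. s i < s (Suc i) \<and> \<xi> i \<in> borel_measurable (F (s i)) \<and>
            bounded (\<xi> i ` space (F (s i))))"

definition simple_process ::
  "nat \<Rightarrow> (nat \<Rightarrow> real) \<Rightarrow> (nat \<Rightarrow> 'w \<Rightarrow> real ^ 'n ^ 'm) \<Rightarrow> real \<Rightarrow> 'w \<Rightarrow> real ^ 'n ^ 'm" where
  "simple_process n s \<xi> r \<omega> = (\<Sum>i<n. indicator {s i<..s (Suc i)} r *\<^sub>R \<xi> i \<omega>)"

definition simple_ito ::
  "(real \<Rightarrow> 'w \<Rightarrow> real ^ 'n) \<Rightarrow> nat \<Rightarrow> (nat \<Rightarrow> real) \<Rightarrow> (nat \<Rightarrow> 'w \<Rightarrow> real ^ 'n ^ 'm) \<Rightarrow>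
   'w \<Rightarrow> real ^ 'm" where
  "simple_ito W n s \<xi> \<omega> = (\<Sum>i<n. \<xi> i \<omega> *v (W (s (Suc i)) \<omega> - W (s i) \<omega>))"

text \<open>\<open>has_ito_integral M F W a b H I\<close>: the random variable \<open>I\<close> is (a version of) the Ito
  integral of \<open>H\<close> with respect to \<open>W\<close> over \<open>[a, b]\<close>. As usual, the integral is the \<open>L\<^sup>2\<close>-limit
  of the integrals of simple processes converging to \<open>H\<close> in \<open>L\<^sup>2(dt \<times> dP)\<close>; by the Ito isometry
  it is unique up to null sets.\<close>

definition has_ito_integral ::
  "'w measure \<Rightarrow> (real \<Rightarrow> 'w measure) \<Rightarrow> (real \<Rightarrow> 'w \<Rightarrow> real ^ 'n) \<Rightarrow> real \<Rightarrow> real \<Rightarrow>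
   (real \<Rightarrow> 'w \<Rightarrow> real ^ 'n ^ 'm) \<Rightarrow> ('w \<Rightarrow> real ^ 'm) \<Rightarrow> bool" where
  "has_ito_integral M F W a b H I \<longleftrightarrow>
     progressively_measurable_on {a..b} F H \<and> I \<in> borel_measurable M \<and>
     (\<exists>(n :: nat \<Rightarrow> nat) s \<xi>.
        (\<forall>k. simple_integrand F a b (n k) (s k) (\<xi> k)) \<and>
        (\<lambda>k. \<integral>\<^sup>+\<omega>. (\<integral>\<^sup>+r\<in>{a..b}. ennreal ((norm (simple_process (n k) (s k) (\<xi> k) r \<omega> - H r \<omega>))\<^sup>2)
               \<partial>lborel) \<partial>M) \<longlonglongrightarrow> 0 \<and>
        (\<lambda>k. \<integral>\<^sup>+\<omega>. ennreal ((norm (simple_ito W (n k) (s k) (\<xi> k) \<omega> - I \<omega>))\<^sup>2) \<partial>M) \<longlonglongrightarrow> 0)"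


section \<open>Controlled processes\<close>

definition strategies ::
  "'w measure \<Rightarrow> (real \<Rightarrow> 'w measure) \<Rightarrow> real \<Rightarrow> (real ^ 'l) set \<Rightarrow> (real \<Rightarrow> 'w \<Rightarrow> real ^ 'l) set" where
  "strategies M F T A =
     {\<alpha>. progressively_measurable_on {0..T} F \<alpha> \<and> (\<forall>t\<in>{0..T}. \<forall>\<omega>\<in>space M. \<alpha> t \<omega> \<in> A)}"

text \<open>\<open>dX = b(\<alpha>, t, X) dt + \<sigma>(\<alpha>, t, X) dW\<close> on \<open>[t0, T]\<close> with \<open>X t0 = x\<close>.\<close>

definition solves_state ::
  "'w measure \<Rightarrow> (real \<Rightarrow> 'w measure) \<Rightarrow> (real \<Rightarrow> 'w \<Rightarrow> real ^ 'd) \<Rightarrow>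
   (real ^ 'l \<Rightarrow> real \<Rightarrow> real ^ 'd \<Rightarrow> real ^ 'd) \<Rightarrow>
   (real ^ 'l \<Rightarrow> real \<Rightarrow> real ^ 'd \<Rightarrow> real ^ 'd ^ 'd) \<Rightarrow>
   real \<Rightarrow> real \<Rightarrow> real ^ 'd \<Rightarrow> (real \<Rightarrow> 'w \<Rightarrow> real ^ 'l) \<Rightarrow> (real \<Rightarrow> 'w \<Rightarrow> real ^ 'd) \<Rightarrow> bool" where
  "solves_state M F W b \<sigma> t0 T x \<alpha> X \<longleftrightarrow>
     progressively_measurable_on {t0..T} F X \<and>
     (AE \<omega> in M. continuous_on {t0..T} (\<lambda>t. X t \<omega>)) \<and>
     (\<exists>I. (\<forall>t\<in>{t0..T}. has_ito_integral M F W t0 t (\<lambda>s \<omega>. \<sigma> (\<alpha> s \<omega>) s (X s \<omega>)) (I t)) \<and>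
          (AE \<omega> in M. \<forall>t\<in>{t0..T}.
             X t \<omega> = x + (LBINT s:{t0..t}. b (\<alpha> s \<omega>) s (X s \<omega>)) + I t \<omega>))"

text \<open>\<open>dY = f(\<alpha>, t, X) dt + \<epsilon> dB\<close> on \<open>[t0, T]\<close> with \<open>Y t0 = y\<close>. The process without noise
  is the case \<open>\<epsilon> = 0\<close>.\<close>

definition solves_cost ::
  "'w measure \<Rightarrow> (real \<Rightarrow> 'w measure) \<Rightarrow> (real \<Rightarrow> 'w \<Rightarrow> real) \<Rightarrow>
   (real ^ 'l \<Rightarrow> real \<Rightarrow> real ^ 'd \<Rightarrow> real) \<Rightarrow> real \<Rightarrow> real \<Rightarrow> real \<Rightarrow> real \<Rightarrow>
   (real \<Rightarrow> 'w \<Rightarrow> real ^ 'l) \<Rightarrow> (real \<Rightarrow> 'w \<Rightarrow> real ^ 'd) \<Rightarrow> (real \<Rightarrow> 'w \<Rightarrow> real) \<Rightarrow> bool" where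
  "solves_cost M F B f t0 T y \<epsilon> \<alpha> X Y \<longleftrightarrow>
     progressively_measurable_on {t0..T} F Y \<and>
     (AE \<omega> in M. \<forall>t\<in>{t0..T}.
        Y t \<omega> = y + (LBINT s:{t0..t}. f (\<alpha> s \<omega>) s (X s \<omega>)) + \<epsilon> * (B t \<omega> - B t0 \<omega>))"

text \<open>The norm on matrices is the library norm on \<open>real ^ 'd ^ 'd\<close>, i.e. the Frobenius norm.\<close>

definition conditions_A0 ::
  "(real ^ 'l) set \<Rightarrow> real \<Rightarrow> (real ^ 'l \<Rightarrow> real \<Rightarrow> real ^ 'd \<Rightarrow> real ^ 'd) \<Rightarrow>
   (real ^ 'l \<Rightarrow> real \<Rightarrow> real ^ 'd \<Rightarrow> real ^ 'd ^ 'd) \<Rightarrow>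
   (real ^ 'l \<Rightarrow> real \<Rightarrow> real ^ 'd \<Rightarrow> real) \<Rightarrow> (real ^ 'd \<Rightarrow> real) \<Rightarrow> bool" where
  "conditions_A0 A T b \<sigma> f \<Phi> \<longleftrightarrow>
     (\<lambda>(a, t, x). \<sigma> a t x) \<in> borel_measurable (restrict_space borel (A \<times> {0..T} \<times> UNIV)) \<and>
     (\<lambda>(a, t, x). b a t x) \<in> borel_measurable (restrict_space borel (A \<times> {0..T} \<times> UNIV)) \<and>
     (\<lambda>(a, t, x). f a t x) \<in> borel_measurable (restrict_space borel (A \<times> {0..T} \<times> UNIV)) \<and>
     (\<forall>t\<in>{0..T}. continuous_on (A \<times> UNIV) (\<lambda>(a, x). \<sigma> a t x) \<and>
                 continuous_on (A \<times> UNIV) (\<lambda>(a, x). b a t x) \<and>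
                 continuous_on (A \<times> UNIV) (\<lambda>(a, x). f a t x)) \<and>
     (\<forall>t\<in>{0..T}. \<forall>x. \<forall>e>0. \<exists>r>0. \<forall>z. dist z x < r \<longrightarrow>
        (\<forall>a\<in>A. dist (\<sigma> a t z) (\<sigma> a t x) < e \<and> dist (b a t z) (b a t x) < e \<and>
               dist (f a t z) (f a t x) < e)) \<and>
     continuous_on UNIV \<Phi> \<and>
     (\<exists>K K1 K2 :: real. \<exists>m :: nat.
        (\<forall>a\<in>A. \<forall>t1\<in>{0..T}. \<forall>t2\<in>{0..T}. \<forall>x z.
           norm (\<sigma> a t1 x - \<sigma> a t2 z) \<le> K1 * (norm (x - z) + \<bar>t1 - t2\<bar>) \<and>
           norm (b a t1 x - b a t2 z) \<le> K1 * (norm (x - z) + \<bar>t1 - t2\<bar>) \<and>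
           \<bar>f a t1 x - f a t2 z\<bar> \<le> K2 * (norm (x - z) + \<bar>t1 - t2\<bar>)) \<and>
        (\<forall>a\<in>A. \<forall>t\<in>{0..T}. \<forall>x. norm (\<sigma> a t x) + norm (b a t x) \<le> K \<and> \<bar>f a t x\<bar> \<le> K2) \<and>
        (\<forall>x. \<bar>\<Phi> x\<bar> \<le> K2 * (1 + norm x ^ m))) \<and>
     (\<exists>c>0. \<forall>a\<in>A. \<forall>t\<in>{0..T}. \<forall>x \<eta>.
        c * (norm \<eta>)\<^sup>2 \<le> \<eta> \<bullet> ((\<sigma> a t x ** transpose (\<sigma> a t x)) *v \<eta>))"


section \<open>Mean-variance functionals and value functions\<close>

definition terminal_gain :: "('x \<Rightarrow> real) \<Rightarrow> 'x \<Rightarrow> real \<Rightarrow> real" where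
  "terminal_gain \<Phi> x y = y + \<Phi> x"

text \<open>\<open>X\<close> and \<open>Y\<close> are families of processes indexed by the strategy; for a fixed initial datum,
  \<open>mv_functional M \<theta> \<Phi> T X Y \<alpha>\<close> is \<open>E g(X\<^sub>T, Y\<^sub>T) - \<theta> Var g(X\<^sub>T, Y\<^sub>T)\<close> under the strategy \<open>\<alpha>\<close>.\<close>

definition mv_functional ::
  "'w measure \<Rightarrow> real \<Rightarrow> ('x \<Rightarrow> real) \<Rightarrow> real \<Rightarrow> ('s \<Rightarrow> real \<Rightarrow> 'w \<Rightarrow> 'x) \<Rightarrow>
   ('s \<Rightarrow> real \<Rightarrow> 'w \<Rightarrow> real) \<Rightarrow> 's \<Rightarrow> real" where
  "mv_functional M \<theta> \<Phi> T X Y \<alpha> =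
     prob_space.expectation M (\<lambda>\<omega>. terminal_gain \<Phi> (X \<alpha> T \<omega>) (Y \<alpha> T \<omega>)) -
     \<theta> * prob_space.variance M (\<lambda>\<omega>. terminal_gain \<Phi> (X \<alpha> T \<omega>) (Y \<alpha> T \<omega>))"

definition value_of :: "'s set \<Rightarrow> ('s \<Rightarrow> real) \<Rightarrow> real" where
  "value_of S J = (SUP \<alpha>\<in>S. J \<alpha>)"

definition optimal :: "'s set \<Rightarrow> ('s \<Rightarrow> real) \<Rightarrow> 's \<Rightarrow> bool" where
  "optimal S J \<alpha> \<longleftrightarrow> \<alpha> \<in> S \<and> J \<alpha> = value_of S J"

definition nearly_optimal :: "real \<Rightarrow> 's set \<Rightarrow> ('s \<Rightarrow> real) \<Rightarrow> 's \<Rightarrow> bool" where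
  "nearly_optimal \<kappa> S J \<alpha> \<longleftrightarrow> \<alpha> \<in> S \<and> value_of S J \<le> J \<alpha> + \<kappa>"

end

theory Submission
  imports Defs
begin

text \<open>The regularised cost is \<open>Y + \<epsilon> (B T - B t0)\<close> almost surely, so the regularisation leaves the mean
  of the terminal gain \<open>G\<close> unchanged, while it changes the variance by
  \<open>2 \<epsilon> Cov(G, B T - B t0) + \<epsilon>\<^sup>2 (T - t0)\<close>. The covariance need not vanish, because strategies may
  depend on \<open>B\<close>, but it is bounded by the second moment of \<open>G\<close>. As \<open>b\<close>, \<open>\<sigma>\<close>, \<open>f\<close> are bounded and
  \<open>\<Phi>\<close> grows polynomially, this second moment is bounded uniformly over all strategies: the Ito
  integral of an integrand bounded by \<open>K\<close> has exponential moments that depend only on \<open>K\<close> and the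
  time horizon. Hence the two functionals differ by at most some \<open>r(\<epsilon>) = O(\<epsilon>)\<close> uniformly in the
  strategy, and \<open>\<delta>(\<epsilon>, \<kappa>) = \<kappa> + 2 r(\<epsilon>)\<close> works.\<close>

section \<open>Increments of Wiener processes\<close>

text \<open>The growth exponent of \<Phi> is arbitrary, so moments of arbitrarily high order are
  called for. A single exponential moment supplies them all, and it multiplies along a partition:
  freezing the past before an increment over a step of length h costs at most a factor exp (K^2 h /
  2), so the product depends only on the total length and not on the partition. The obstacle is that
  an Ito integral is given only as an L^2 limit of integrals of simple processes whose values are
  bounded for each index but not uniformly in the index, so the approximating integrals carry no
  common exponential bound until their coefficients are truncated. The uniform second moment serves
  a second purpose besides the covariance: it bounds the functionals over all strategies, and only
  for bounded families is the real-valued supremum an upper bound that values can be compared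
  with.\<close>

lemma nn_integral_exp_normal:
  fixes a v :: real
  assumes "0 < v"
  shows "(\<integral>\<^sup>+z. ennreal (normal_density 0 (sqrt v) z) * ennreal (exp (a * z)) \<partial>lborel)
    = ennreal (exp (a\<^sup>2 * v / 2))"
proof -
  have completed_square: "- z\<^sup>2 / (2 * v) + a * z = a\<^sup>2 * v / 2 - (z - a * v)\<^sup>2 / (2 * v)" for z
    using assms by (simp add: field_simps power2_eq_square)
  have "normal_density 0 (sqrt v) z * exp (a * z)
      = exp (a\<^sup>2 * v / 2) * normal_density (a * v) (sqrt v) z" for z
  proof -
    have "exp (- z\<^sup>2 / (2 * v)) * exp (a * z) = exp (a\<^sup>2 * v / 2) * exp (- (z - a * v)\<^sup>2 / (2 * v))"
      unfolding exp_add[symmetric] completed_square by simp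
    then show ?thesis
      using assms by (simp add: normal_density_def)
  qed
  then have "(\<integral>\<^sup>+z. ennreal (normal_density 0 (sqrt v) z) * ennreal (exp (a * z)) \<partial>lborel)
      = (\<integral>\<^sup>+z. ennreal (exp (a\<^sup>2 * v / 2)) * ennreal (normal_density (a * v) (sqrt v) z) \<partial>lborel)"
    by (simp add: ennreal_mult'[symmetric])
  also have "\<dots> = ennreal (exp (a\<^sup>2 * v / 2))
      * (\<integral>\<^sup>+z. ennreal (normal_density (a * v) (sqrt v) z) \<partial>lborel)"
    by (rule nn_integral_cmult) simp
  also have "(\<integral>\<^sup>+z. ennreal (normal_density (a * v) (sqrt v) z) \<partial>lborel) = 1"
    using assms by (subst nn_integral_eq_integral) auto
  finally show ?thesis
    by simp
qed

text \<open>Independence makes the joint law of \<open>U\<close> and \<open>D\<close> the product of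
  their laws, which is checked on rectangles; Tonelli then integrates \<open>D\<close> out with
  \<open>U\<close> held fixed. This does the work of conditioning on \<open>G\<close> without
  conditional expectations.\<close>

lemma (in prob_space) nn_integral_indep_vimage_algebra:
  fixes U :: "'a \<Rightarrow> 'u::topological_space" and D :: "'a \<Rightarrow> 'd::topological_space"
    and h :: "'u \<times> 'd \<Rightarrow> ennreal"
  assumes G: "subalgebra M G" and U: "U \<in> borel_measurable G" and D: "D \<in> borel_measurable M"
    and indep: "indep_set (sets G) (sets (vimage_algebra (space M) D borel))"
    and h[measurable]: "h \<in> borel_measurable (borel \<Otimes>\<^sub>M borel)"
  shows "(\<integral>\<^sup>+\<omega>. h (U \<omega>, D \<omega>) \<partial>M) = (\<integral>\<^sup>+\<omega>. (\<integral>\<^sup>+\<omega>'. h (U \<omega>, D \<omega>') \<partial>M) \<partial>M)"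
proof -
  note D[measurable]
  have U'[measurable]: "U \<in> borel_measurable M"
    using measurable_from_subalg[OF G U] .
  interpret U: prob_space "distr M borel U"
    by (rule prob_space_distr) simp
  interpret D: prob_space "distr M borel D"
    by (rule prob_space_distr) simp
  have eq: "distr M borel U \<Otimes>\<^sub>M distr M borel D = distr M (borel \<Otimes>\<^sub>M borel) (\<lambda>\<omega>. (U \<omega>, D \<omega>))"
  proof (rule pair_measure_eqI[OF U.sigma_finite_measure D.sigma_finite_measure])
    fix A B assume A: "A \<in> sets (distr M borel U)" and B: "B \<in> sets (distr M borel D)"
    have "U -` A \<inter> space M \<in> sets G"
      using measurable_sets[OF U, of A] A G by (simp add: subalgebra_def)
    moreover have "D -` B \<inter> space M \<in> sets (vimage_algebra (space M) D borel)"
      using B by (simp add: in_vimage_algebra)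
    ultimately have "prob ((U -` A \<inter> space M) \<inter> (D -` B \<inter> space M))
        = prob (U -` A \<inter> space M) * prob (D -` B \<inter> space M)"
      by (rule indep_setD[OF indep])
    moreover have "(U -` A \<inter> space M) \<inter> (D -` B \<inter> space M) = (\<lambda>\<omega>. (U \<omega>, D \<omega>)) -` (A \<times> B) \<inter> space M"
      by auto
    ultimately show "emeasure (distr M borel U) A * emeasure (distr M borel D) B
        = emeasure (distr M (borel \<Otimes>\<^sub>M borel) (\<lambda>\<omega>. (U \<omega>, D \<omega>))) (A \<times> B)"
      using A B by (simp add: emeasure_distr emeasure_eq_measure ennreal_mult)
  qed simp
  have "(\<integral>\<^sup>+\<omega>. h (U \<omega>, D \<omega>) \<partial>M) = (\<integral>\<^sup>+p. h p \<partial>(distr M borel U \<Otimes>\<^sub>M distr M borel D))"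
    unfolding eq by (subst nn_integral_distr) auto
  also have "\<dots> = (\<integral>\<^sup>+u. (\<integral>\<^sup>+d. h (u, d) \<partial>distr M borel D) \<partial>distr M borel U)"
    by (subst D.nn_integral_fst[symmetric]) auto
  also have "\<dots> = (\<integral>\<^sup>+u. (\<integral>\<^sup>+\<omega>'. h (u, D \<omega>') \<partial>M) \<partial>distr M borel U)"
    by (subst nn_integral_distr) auto
  also have "\<dots> = (\<integral>\<^sup>+\<omega>. (\<integral>\<^sup>+\<omega>'. h (U \<omega>, D \<omega>') \<partial>M) \<partial>M)"
    by (rule nn_integral_distr) auto
  finally show ?thesis .
qed

locale wiener_space = filtered_prob_space M F
  for M :: "'w measure" and F :: "real \<Rightarrow> 'w measure" +
  fixes Z :: "real \<Rightarrow> 'w \<Rightarrow> 'b::euclidean_space"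
  assumes wiener: "wiener_process M F Z"
begin

lemma measurable_F_mono:
  assumes "0 \<le> s" "s \<le> t" "U \<in> borel_measurable (F s)"
  shows "U \<in> borel_measurable (F t)"
proof (rule measurable_from_subalg[OF _ assms(3)])
  have "space (F s) = space (F t)"
    using subalgebra_F[of s] subalgebra_F[of t] assms by (simp add: subalgebra_def)
  then show "subalgebra (F t) (F s)"
    using F_mono[of s t] assms by (simp add: subalgebra_def)
qed

lemma Z_measurable_F: "0 \<le> s \<Longrightarrow> s \<le> t \<Longrightarrow> Z s \<in> borel_measurable (F t)"
  using wiener measurable_F_mono unfolding wiener_process_def by blast

lemma Z_measurable: "0 \<le> t \<Longrightarrow> Z t \<in> borel_measurable M"
  using Z_measurable_F[of t t] measurable_from_subalg[OF subalgebra_F] by blast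

lemma increment_measurable: "0 \<le> s \<Longrightarrow> s < t \<Longrightarrow> (\<lambda>\<omega>. Z t \<omega> - Z s \<omega>) \<in> borel_measurable M"
  using Z_measurable[of s] Z_measurable[of t] by measurable

lemma increment_distributed:
  assumes "0 \<le> s" "s < t" "i \<in> Basis"
  shows "distributed M lborel (\<lambda>\<omega>. (Z t \<omega> - Z s \<omega>) \<bullet> i) (normal_density 0 (sqrt (t - s)))"
  using wiener assms unfolding wiener_process_def by blast

text \<open>The Gaussian law is prescribed for \<open>s < t\<close> only. The degenerate case
  \<open>s = t\<close> is included because the initial time may later coincide with the terminal
  time.\<close>

lemma increment_moments:
  assumes "0 \<le> s" "s \<le> t" and i: "i \<in> Basis"
  shows "integrable M (\<lambda>\<omega>. (Z t \<omega> - Z s \<omega>) \<bullet> i)"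
    and "expectation (\<lambda>\<omega>. (Z t \<omega> - Z s \<omega>) \<bullet> i) = 0"
    and "integrable M (\<lambda>\<omega>. ((Z t \<omega> - Z s \<omega>) \<bullet> i)\<^sup>2)"
    and "expectation (\<lambda>\<omega>. ((Z t \<omega> - Z s \<omega>) \<bullet> i)\<^sup>2) = t - s"
proof -
  have "integrable M (\<lambda>\<omega>. (Z t \<omega> - Z s \<omega>) \<bullet> i) \<and> expectation (\<lambda>\<omega>. (Z t \<omega> - Z s \<omega>) \<bullet> i) = 0 \<and>
    integrable M (\<lambda>\<omega>. ((Z t \<omega> - Z s \<omega>) \<bullet> i)\<^sup>2) \<and> expectation (\<lambda>\<omega>. ((Z t \<omega> - Z s \<omega>) \<bullet> i)\<^sup>2) = t - s"
  proof (cases "s = t")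
    case False
    then have st: "0 \<le> s" "s < t"
      using assms by auto
    note D = increment_distributed[OF st i]
    have v: "0 < sqrt (t - s)"
      using st by simp
    have e: "expectation (\<lambda>\<omega>. (Z t \<omega> - Z s \<omega>) \<bullet> i) = 0"
      using normal_distributed_expectation[OF v D] .
    show ?thesis
      using e integrable_normal_moment_nz_1[OF v, of 0] distributed_integrable[OF D, of "\<lambda>x. x"]
        integrable_normal_moment[OF v, of 0 2] distributed_integrable[OF D, of "\<lambda>x. x\<^sup>2"]
        normal_distributed_variance[OF v D] st by auto
  qed simp
  then show "integrable M (\<lambda>\<omega>. (Z t \<omega> - Z s \<omega>) \<bullet> i)"
    and "expectation (\<lambda>\<omega>. (Z t \<omega> - Z s \<omega>) \<bullet> i) = 0"
    and "integrable M (\<lambda>\<omega>. ((Z t \<omega> - Z s \<omega>) \<bullet> i)\<^sup>2)"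
    and "expectation (\<lambda>\<omega>. ((Z t \<omega> - Z s \<omega>) \<bullet> i)\<^sup>2) = t - s"
    by auto
qed

text \<open>Independence of the coordinates factorises the exponential of the inner product into
  one-dimensional Gaussian moment generating functions, whose exponents add up to the squared norm
  of \<open>u\<close>.\<close>

lemma nn_integral_exp_increment:
  assumes st: "0 \<le> s" "s < t"
  shows "(\<integral>\<^sup>+\<omega>. ennreal (exp (u \<bullet> (Z t \<omega> - Z s \<omega>))) \<partial>M) = ennreal (exp ((norm u)\<^sup>2 * (t - s) / 2))"
proof -
  let ?D = "\<lambda>i \<omega>. (Z t \<omega> - Z s \<omega>) \<bullet> i"
  have ind: "indep_vars (\<lambda>_. borel) ?D Basis"
    using wiener st unfolding wiener_process_def by blast
  have "exp (u \<bullet> (Z t \<omega> - Z s \<omega>)) = (\<Prod>i\<in>Basis. exp ((u \<bullet> i) * ?D i \<omega>))" for \<omega>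
    by (subst euclidean_inner) (simp add: exp_sum)
  then have "(\<integral>\<^sup>+\<omega>. ennreal (exp (u \<bullet> (Z t \<omega> - Z s \<omega>))) \<partial>M)
      = (\<integral>\<^sup>+\<omega>. (\<Prod>i\<in>Basis. ennreal (exp ((u \<bullet> i) * ?D i \<omega>))) \<partial>M)"
    by (simp add: prod_ennreal)
  also have "\<dots> = (\<Prod>i\<in>Basis. \<integral>\<^sup>+\<omega>. ennreal (exp ((u \<bullet> i) * ?D i \<omega>)) \<partial>M)"
    by (rule indep_vars_nn_integral) (auto intro!: indep_vars_compose2[OF ind])
  also have "\<dots> = (\<Prod>i\<in>Basis. ennreal (exp ((u \<bullet> i)\<^sup>2 * (t - s) / 2)))"
  proof (rule prod.cong[OF refl])
    fix i :: 'b assume i: "i \<in> Basis"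
    show "(\<integral>\<^sup>+\<omega>. ennreal (exp ((u \<bullet> i) * ?D i \<omega>)) \<partial>M) = ennreal (exp ((u \<bullet> i)\<^sup>2 * (t - s) / 2))"
      using distributed_nn_integral[OF increment_distributed[OF st i],
          of "\<lambda>z. ennreal (exp ((u \<bullet> i) * z))"] nn_integral_exp_normal[of "t - s" "u \<bullet> i"] st
      by simp
  qed
  also have "\<dots> = ennreal (exp (\<Sum>i\<in>Basis. (u \<bullet> i)\<^sup>2 * (t - s) / 2))"
    by (simp add: prod_ennreal exp_sum)
  also have "(\<Sum>i\<in>Basis. (u \<bullet> i)\<^sup>2 * (t - s) / 2) = (norm u)\<^sup>2 * (t - s) / 2"
    unfolding power2_norm_eq_inner
    by (subst euclidean_inner) (simp add: sum_distrib_right sum_divide_distrib power2_eq_square)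
  finally show ?thesis .
qed

text \<open>The mean zero of the increment removes the cross term. Cauchy-Schwarz replaces the
  square of \<open>u \<bullet> (Z t \<omega> - Z s \<omega>)\<close> by a sum of squared
  coordinates, so that no covariances between coordinates have to be computed. The price is the
  dimension factor, which is harmless because the bound is only applied to quantities tending to
  0.\<close>

lemma nn_integral_square_increment:
  fixes s t c :: real
  assumes st: "0 \<le> s" "s < t"
  shows "(\<integral>\<^sup>+\<omega>. ennreal ((c + u \<bullet> (Z t \<omega> - Z s \<omega>))\<^sup>2) \<partial>M)
    \<le> ennreal (c\<^sup>2) + ennreal (DIM('b) * (t - s)) * ennreal ((norm u)\<^sup>2)"
proof -
  let ?D = "\<lambda>\<omega>. Z t \<omega> - Z s \<omega>"
  have sq: "(c + u \<bullet> ?D \<omega>)\<^sup>2 \<le> c\<^sup>2 + 2 * c * (\<Sum>i\<in>Basis. (u \<bullet> i) * (?D \<omega> \<bullet> i))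
      + (norm u)\<^sup>2 * (\<Sum>i\<in>Basis. (?D \<omega> \<bullet> i)\<^sup>2)" for \<omega>
  proof -
    have "(u \<bullet> ?D \<omega>)\<^sup>2 \<le> (norm u)\<^sup>2 * (norm (?D \<omega>))\<^sup>2"
      using power_mono[OF Cauchy_Schwarz_ineq2[of u "?D \<omega>"], of 2] by (simp add: power_mult_distrib)
    moreover have "(norm (?D \<omega>))\<^sup>2 = (\<Sum>i\<in>Basis. (?D \<omega> \<bullet> i)\<^sup>2)"
      unfolding power2_norm_eq_inner by (subst euclidean_inner) (simp add: power2_eq_square)
    moreover have "u \<bullet> ?D \<omega> = (\<Sum>i\<in>Basis. (u \<bullet> i) * (?D \<omega> \<bullet> i))"
      by (rule euclidean_inner)
    ultimately show ?thesis
      by (simp add: power2_sum algebra_simps)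
  qed
  have int: "has_bochner_integral M (\<lambda>\<omega>. c\<^sup>2 + 2 * c * (\<Sum>i\<in>Basis. (u \<bullet> i) * (?D \<omega> \<bullet> i))
      + (norm u)\<^sup>2 * (\<Sum>i\<in>Basis. (?D \<omega> \<bullet> i)\<^sup>2))
      (c\<^sup>2 + 2 * c * (\<Sum>i\<in>(Basis::'b set). (u \<bullet> i) * 0) + (norm u)\<^sup>2 * (\<Sum>i\<in>(Basis::'b set). (t - s)))"
    by (intro has_bochner_integral_add has_bochner_integral_mult_right has_bochner_integral_sum)
      (auto simp: has_bochner_integral_iff increment_moments[OF st(1) less_imp_le[OF st(2)]] prob_space)
  have "(\<integral>\<^sup>+\<omega>. ennreal ((c + u \<bullet> ?D \<omega>)\<^sup>2) \<partial>M)
      \<le> (\<integral>\<^sup>+\<omega>. ennreal (c\<^sup>2 + 2 * c * (\<Sum>i\<in>Basis. (u \<bullet> i) * (?D \<omega> \<bullet> i))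
      + (norm u)\<^sup>2 * (\<Sum>i\<in>Basis. (?D \<omega> \<bullet> i)\<^sup>2)) \<partial>M)"
    by (intro nn_integral_mono ennreal_leI sq)
  \<comment> \<open>The integrand is nonnegative because it dominates a square, so its Bochner
    integral may replace the nonnegative integral.\<close>
  also have "\<dots> = ennreal (c\<^sup>2 + 2 * c * (\<Sum>i\<in>(Basis::'b set). (u \<bullet> i) * 0)
      + (norm u)\<^sup>2 * (\<Sum>i\<in>(Basis::'b set). (t - s)))"
    using int unfolding has_bochner_integral_iff
    by (subst nn_integral_eq_integral) (auto intro!: AE_I2 order_trans[OF _ sq])
  also have "\<dots> = ennreal (c\<^sup>2 + (DIM('b) * (t - s)) * (norm u)\<^sup>2)"
    by (simp add: mult_ac)
  also have "\<dots> = ennreal (c\<^sup>2) + ennreal (DIM('b) * (t - s)) * ennreal ((norm u)\<^sup>2)"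
    using st by (simp add: ennreal_plus ennreal_mult)
  finally show ?thesis .
qed

text \<open>Intended for \<open>U\<close> the pair of the sum accumulated up to time
  \<open>s\<close> and the next coefficient, both of which are known at that time.\<close>

lemma nn_integral_increment:
  fixes U :: "'w \<Rightarrow> 'u::topological_space" and h :: "'u \<times> 'b \<Rightarrow> ennreal"
  assumes st: "0 \<le> s" "s < t" and U: "U \<in> borel_measurable (F s)"
    and h: "h \<in> borel_measurable (borel \<Otimes>\<^sub>M borel)"
  shows "(\<integral>\<^sup>+\<omega>. h (U \<omega>, Z t \<omega> - Z s \<omega>) \<partial>M)
    = (\<integral>\<^sup>+\<omega>. (\<integral>\<^sup>+\<omega>'. h (U \<omega>, Z t \<omega>' - Z s \<omega>') \<partial>M) \<partial>M)"
proof (rule nn_integral_indep_vimage_algebra[where D = "\<lambda>\<omega>. Z t \<omega> - Z s \<omega>", OF subalgebra_F U _ _ h])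
  show "indep_set (sets (F s)) (sets (vimage_algebra (space M) (\<lambda>\<omega>. Z t \<omega> - Z s \<omega>) borel))"
    using wiener st unfolding wiener_process_def by blast
qed (use st increment_measurable in auto)

end

section \<open>Sums of increments and exponential moments of Ito integrals\<close>

context wiener_space
begin

text \<open>With the partial sum and the last coefficient frozen, the last increment contributes the
  factor exp (K^2 h / 2) at most, where h is its length, and these factors telescope. Nonnegativity
  of \<open>s n\<close> and adaptedness of the sum are carried through the induction because the
  next independence step needs both.\<close>

lemma nn_integral_exp_simple_sum:
  assumes "0 \<le> s 0" and "\<And>i. i < n \<Longrightarrow> s i < s (Suc i)"
    and "\<And>i. i < n \<Longrightarrow> u i \<in> borel_measurable (F (s i))"
    and "\<And>i \<omega>. i < n \<Longrightarrow> \<omega> \<in> space M \<Longrightarrow> norm (u i \<omega>) \<le> K"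
  shows "0 \<le> s n \<and>
    (\<lambda>\<omega>. \<Sum>i<n. u i \<omega> \<bullet> (Z (s (Suc i)) \<omega> - Z (s i) \<omega>)) \<in> borel_measurable (F (s n)) \<and>
    (\<integral>\<^sup>+\<omega>. ennreal (exp (\<Sum>i<n. u i \<omega> \<bullet> (Z (s (Suc i)) \<omega> - Z (s i) \<omega>))) \<partial>M)
      \<le> ennreal (exp (K\<^sup>2 * (s n - s 0) / 2))"
  using assms
proof (induction n)
  case 0
  then show ?case
    by (simp add: emeasure_space_1)
next
  case (Suc n)
  let ?S = "\<lambda>\<omega>. \<Sum>i<n. u i \<omega> \<bullet> (Z (s (Suc i)) \<omega> - Z (s i) \<omega>)"
  let ?h = "\<lambda>((a :: real, v), d :: 'b). ennreal (exp (a + v \<bullet> d))"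
  have IH: "0 \<le> s n" "?S \<in> borel_measurable (F (s n))"
    "(\<integral>\<^sup>+\<omega>. ennreal (exp (?S \<omega>)) \<partial>M) \<le> ennreal (exp (K\<^sup>2 * (s n - s 0) / 2))"
    using Suc by auto
  have step: "s n < s (Suc n)" and un: "u n \<in> borel_measurable (F (s n))"
    and bn: "\<And>\<omega>. \<omega> \<in> space M \<Longrightarrow> norm (u n \<omega>) \<le> K"
    using Suc.prems by auto
  have SM: "?S \<in> borel_measurable M"
    using measurable_from_subalg[OF subalgebra_F[OF IH(1)] IH(2)] .
  have meas: "(\<lambda>\<omega>. \<Sum>i<Suc n. u i \<omega> \<bullet> (Z (s (Suc i)) \<omega> - Z (s i) \<omega>)) \<in> borel_measurable (F (s (Suc n)))"
    using measurable_F_mono[OF IH(1) less_imp_le[OF step] IH(2)]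
      measurable_F_mono[OF IH(1) less_imp_le[OF step] un]
      Z_measurable_F[of "s n" "s (Suc n)"] Z_measurable_F[of "s (Suc n)" "s (Suc n)"] IH(1) step
    by (simp add: borel_measurable_add borel_measurable_inner borel_measurable_diff)
  have h: "?h \<in> borel_measurable (borel \<Otimes>\<^sub>M borel)"
    unfolding borel_prod case_prod_unfold
    by (intro measurable_compose[OF _ measurable_ennreal] borel_measurable_continuous_onI
        continuous_intros)
  have "(\<integral>\<^sup>+\<omega>. ennreal (exp (\<Sum>i<Suc n. u i \<omega> \<bullet> (Z (s (Suc i)) \<omega> - Z (s i) \<omega>))) \<partial>M)
      = (\<integral>\<^sup>+\<omega>. ?h ((?S \<omega>, u n \<omega>), Z (s (Suc n)) \<omega> - Z (s n) \<omega>) \<partial>M)"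
    by simp
  also have "\<dots> = (\<integral>\<^sup>+\<omega>. (\<integral>\<^sup>+\<omega>'. ?h ((?S \<omega>, u n \<omega>), Z (s (Suc n)) \<omega>' - Z (s n) \<omega>') \<partial>M) \<partial>M)"
    by (rule nn_integral_increment[OF IH(1) step borel_measurable_Pair[OF IH(2) un] h])
  also have "\<dots> \<le> (\<integral>\<^sup>+\<omega>. ennreal (exp (K\<^sup>2 * (s (Suc n) - s n) / 2)) * ennreal (exp (?S \<omega>)) \<partial>M)"
  proof (rule nn_integral_mono)
    fix \<omega> assume \<omega>: "\<omega> \<in> space M"
    have "(\<integral>\<^sup>+\<omega>'. ?h ((?S \<omega>, u n \<omega>), Z (s (Suc n)) \<omega>' - Z (s n) \<omega>') \<partial>M)
        = (\<integral>\<^sup>+\<omega>'. ennreal (exp (?S \<omega>)) * ennreal (exp (u n \<omega> \<bullet> (Z (s (Suc n)) \<omega>' - Z (s n) \<omega>'))) \<partial>M)"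
      by (simp add: exp_add ennreal_mult)
    also have "\<dots> = ennreal (exp (?S \<omega>)) * ennreal (exp ((norm (u n \<omega>))\<^sup>2 * (s (Suc n) - s n) / 2))"
      using increment_measurable[OF IH(1) step]
      by (subst nn_integral_cmult) (auto simp: nn_integral_exp_increment[OF IH(1) step])
    also have "\<dots> \<le> ennreal (exp (?S \<omega>)) * ennreal (exp (K\<^sup>2 * (s (Suc n) - s n) / 2))"
      using bn[OF \<omega>] step by (intro mult_left_mono ennreal_leI) (auto intro!: mult_right_mono power_mono)
    finally show "(\<integral>\<^sup>+\<omega>'. ?h ((?S \<omega>, u n \<omega>), Z (s (Suc n)) \<omega>' - Z (s n) \<omega>') \<partial>M)
        \<le> ennreal (exp (K\<^sup>2 * (s (Suc n) - s n) / 2)) * ennreal (exp (?S \<omega>))"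
      by (simp add: mult.commute)
  qed
  also have "\<dots> = ennreal (exp (K\<^sup>2 * (s (Suc n) - s n) / 2)) * (\<integral>\<^sup>+\<omega>. ennreal (exp (?S \<omega>)) \<partial>M)"
    by (intro nn_integral_cmult measurable_compose[OF SM]) measurable
  also have "\<dots> \<le> ennreal (exp (K\<^sup>2 * (s (Suc n) - s n) / 2)) * ennreal (exp (K\<^sup>2 * (s n - s 0) / 2))"
    by (intro mult_left_mono IH) simp
  also have "\<dots> = ennreal (exp (K\<^sup>2 * (s (Suc n) - s 0) / 2))"
    by (simp add: ennreal_mult[symmetric] exp_add[symmetric] field_simps)
  finally show ?case
    using meas IH(1) step by auto
qed

text \<open>This is the Ito isometry weakened to an inequality with a dimension factor. The
  integrals on the right may be infinite, so the coefficients are only required to be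
  adapted.\<close>

lemma nn_integral_square_simple_sum:
  fixes s :: "nat \<Rightarrow> real"
  assumes "0 \<le> s 0" and "\<And>i. i < n \<Longrightarrow> s i < s (Suc i)"
    and "\<And>i. i < n \<Longrightarrow> u i \<in> borel_measurable (F (s i))"
  shows "0 \<le> s n \<and>
    (\<lambda>\<omega>. \<Sum>i<n. u i \<omega> \<bullet> (Z (s (Suc i)) \<omega> - Z (s i) \<omega>)) \<in> borel_measurable (F (s n)) \<and>
    (\<integral>\<^sup>+\<omega>. ennreal ((\<Sum>i<n. u i \<omega> \<bullet> (Z (s (Suc i)) \<omega> - Z (s i) \<omega>))\<^sup>2) \<partial>M)
      \<le> (\<Sum>i<n. ennreal (DIM('b) * (s (Suc i) - s i)) * (\<integral>\<^sup>+\<omega>. ennreal ((norm (u i \<omega>))\<^sup>2) \<partial>M))"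
  using assms
proof (induction n)
  case 0
  then show ?case
    by simp
next
  case (Suc n)
  let ?S = "\<lambda>\<omega>. \<Sum>i<n. u i \<omega> \<bullet> (Z (s (Suc i)) \<omega> - Z (s i) \<omega>)"
  let ?h = "\<lambda>((a :: real, v), d :: 'b). ennreal ((a + v \<bullet> d)\<^sup>2)"
  let ?c = "ennreal (DIM('b) * (s (Suc n) - s n))"
  let ?B = "\<Sum>i<n. ennreal (DIM('b) * (s (Suc i) - s i)) * (\<integral>\<^sup>+\<omega>. ennreal ((norm (u i \<omega>))\<^sup>2) \<partial>M)"
  have IH: "0 \<le> s n" "?S \<in> borel_measurable (F (s n))" "(\<integral>\<^sup>+\<omega>. ennreal ((?S \<omega>)\<^sup>2) \<partial>M) \<le> ?B"
    using Suc by auto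
  have step: "s n < s (Suc n)" and un: "u n \<in> borel_measurable (F (s n))"
    using Suc.prems by auto
  have SM: "?S \<in> borel_measurable M" and uM: "u n \<in> borel_measurable M"
    using measurable_from_subalg[OF subalgebra_F[OF IH(1)]] IH(2) un by blast+
  have meas: "(\<lambda>\<omega>. \<Sum>i<Suc n. u i \<omega> \<bullet> (Z (s (Suc i)) \<omega> - Z (s i) \<omega>)) \<in> borel_measurable (F (s (Suc n)))"
    using measurable_F_mono[OF IH(1) less_imp_le[OF step] IH(2)]
      measurable_F_mono[OF IH(1) less_imp_le[OF step] un]
      Z_measurable_F[of "s n" "s (Suc n)"] Z_measurable_F[of "s (Suc n)" "s (Suc n)"] IH(1) step
    by (simp add: borel_measurable_add borel_measurable_inner borel_measurable_diff)
  have h: "?h \<in> borel_measurable (borel \<Otimes>\<^sub>M borel)"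
    unfolding borel_prod case_prod_unfold
    by (intro measurable_compose[OF _ measurable_ennreal] borel_measurable_continuous_onI
        continuous_intros)
  have "(\<integral>\<^sup>+\<omega>. ennreal ((\<Sum>i<Suc n. u i \<omega> \<bullet> (Z (s (Suc i)) \<omega> - Z (s i) \<omega>))\<^sup>2) \<partial>M)
      = (\<integral>\<^sup>+\<omega>. ?h ((?S \<omega>, u n \<omega>), Z (s (Suc n)) \<omega> - Z (s n) \<omega>) \<partial>M)"
    by simp
  also have "\<dots> = (\<integral>\<^sup>+\<omega>. (\<integral>\<^sup>+\<omega>'. ?h ((?S \<omega>, u n \<omega>), Z (s (Suc n)) \<omega>' - Z (s n) \<omega>') \<partial>M) \<partial>M)"
    by (rule nn_integral_increment[OF IH(1) step borel_measurable_Pair[OF IH(2) un] h])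
  also have "\<dots> \<le> (\<integral>\<^sup>+\<omega>. ennreal ((?S \<omega>)\<^sup>2) + ?c * ennreal ((norm (u n \<omega>))\<^sup>2) \<partial>M)"
    using nn_integral_square_increment[OF IH(1) step] by (intro nn_integral_mono) simp
  also have "\<dots> = (\<integral>\<^sup>+\<omega>. ennreal ((?S \<omega>)\<^sup>2) \<partial>M) + ?c * (\<integral>\<^sup>+\<omega>. ennreal ((norm (u n \<omega>))\<^sup>2) \<partial>M)"
    using SM uM by (subst nn_integral_add) (auto simp: nn_integral_cmult)
  also have "\<dots> \<le> ?B + ?c * (\<integral>\<^sup>+\<omega>. ennreal ((norm (u n \<omega>))\<^sup>2) \<partial>M)"
    by (intro add_right_mono IH)
  finally show ?case
    using meas IH(1) step by auto
qed

end

section \<open>Partitions and the distance between a simple process and its target\<close>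

lemma partition_mono:
  fixes s :: "nat \<Rightarrow> real"
  assumes "\<And>i. i < n \<Longrightarrow> s i < s (Suc i)" "i \<le> k" "k \<le> n"
  shows "s i \<le> s k"
  using assms(2,3)
proof (induction k rule: dec_induct)
  case (step k)
  then show ?case
    using assms(1)[of k] by auto
qed simp

lemma partition_unique:
  fixes s :: "nat \<Rightarrow> real"
  assumes s: "\<And>i. i < n \<Longrightarrow> s i < s (Suc i)" and "i < n" "k < n"
    and "r \<in> {s i<..s (Suc i)}" "r \<in> {s k<..s (Suc k)}"
  shows "i = k"
proof (rule ccontr)
  assume "i \<noteq> k"
  then have "Suc i \<le> k \<or> Suc k \<le> i"
    by auto
  then show False
    using partition_mono[of n s "Suc i" k, OF s] partition_mono[of n s "Suc k" i, OF s] assms(2-)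
    by auto
qed

lemma simple_process_eq:
  assumes "\<And>i. i < n \<Longrightarrow> s i < s (Suc i)" "k < n" "r \<in> {s k<..s (Suc k)}"
  shows "simple_process n s \<xi> r \<omega> = \<xi> k \<omega>"
proof -
  have "simple_process n s \<xi> r \<omega> = (\<Sum>i<n. if i = k then \<xi> k \<omega> else 0)"
    unfolding simple_process_def
  proof (intro sum.cong refl)
    fix i assume "i \<in> {..<n}"
    then have "r \<in> {s i<..s (Suc i)} \<longleftrightarrow> i = k"
      using partition_unique[of n s i k r, OF assms(1)] assms(2,3) by auto
    then show "indicator {s i<..s (Suc i)} r *\<^sub>R \<xi> i \<omega> = (if i = k then \<xi> k \<omega> else 0)"
      by (simp add: indicator_def)
  qed
  then show ?thesis
    using assms(2) by simp
qed

text \<open>On each partition interval the simple process equals its coefficient there, so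
  \<open>q\<close> lies pointwise below the integrand. This converts a sum over the partition, as
  produced by the isometry estimate, into the L^2 distance occurring in the definition of the Ito
  integral.\<close>

lemma simple_sum_le_process_distance:
  fixes \<xi> :: "nat \<Rightarrow> 'w \<Rightarrow> real ^ 'n ^ 'm"
  assumes s: "\<And>i. i < n \<Longrightarrow> s i < s (Suc i)"
    and le: "\<And>i r. i < n \<Longrightarrow> r \<in> {s 0..s n} \<Longrightarrow> q i \<le> (norm (\<xi> i \<omega> - H r \<omega>))\<^sup>2"
  shows "(\<Sum>i<n. ennreal (s (Suc i) - s i) * ennreal (q i))
    \<le> (\<integral>\<^sup>+r\<in>{s 0..s n}. ennreal ((norm (simple_process n s \<xi> r \<omega> - H r \<omega>))\<^sup>2) \<partial>lborel)"
proof -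
  have "(\<Sum>i<n. ennreal (s (Suc i) - s i) * ennreal (q i))
      = (\<Sum>i<n. \<integral>\<^sup>+r. ennreal (q i) * indicator {s i<..s (Suc i)} r \<partial>lborel)"
    using s by (intro sum.cong) (auto simp: nn_integral_cmult less_imp_le mult.commute)
  also have "\<dots> = (\<integral>\<^sup>+r. (\<Sum>i<n. ennreal (q i) * indicator {s i<..s (Suc i)} r) \<partial>lborel)"
    by (subst nn_integral_sum) auto
  also have "\<dots> \<le> (\<integral>\<^sup>+r\<in>{s 0..s n}. ennreal ((norm (simple_process n s \<xi> r \<omega> - H r \<omega>))\<^sup>2) \<partial>lborel)"
  proof (rule nn_integral_mono)
    fix r
    show "(\<Sum>i<n. ennreal (q i) * indicator {s i<..s (Suc i)} r)
        \<le> ennreal ((norm (simple_process n s \<xi> r \<omega> - H r \<omega>))\<^sup>2) * indicator {s 0..s n} r"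
    proof (cases "\<exists>k<n. r \<in> {s k<..s (Suc k)}")
      case True
      then obtain k where k: "k < n" "r \<in> {s k<..s (Suc k)}"
        by auto
      have "(\<Sum>i<n. ennreal (q i) * indicator {s i<..s (Suc i)} r) = (\<Sum>i<n. if i = k then ennreal (q k) else 0)"
      proof (intro sum.cong refl)
        fix i assume "i \<in> {..<n}"
        then have "r \<in> {s i<..s (Suc i)} \<longleftrightarrow> i = k"
          using partition_unique[of n s i k r, OF s] k by auto
        then show "ennreal (q i) * indicator {s i<..s (Suc i)} r = (if i = k then ennreal (q k) else 0)"
          by (simp add: indicator_def)
      qed
      also have "\<dots> = ennreal (q k)"
        using k(1) by simp
      finally have sum_eq: "(\<Sum>i<n. ennreal (q i) * indicator {s i<..s (Suc i)} r) = ennreal (q k)" .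
      show ?thesis
      proof -
        have "s 0 \<le> s k" "s (Suc k) \<le> s n"
          using partition_mono[of n s 0 k, OF s] partition_mono[of n s "Suc k" n, OF s] k(1) by auto
        then have r: "r \<in> {s 0..s n}"
          using k(2) by auto
        have "simple_process n s \<xi> r \<omega> = \<xi> k \<omega>"
          by (rule simple_process_eq[OF s k])
        then show ?thesis
          using sum_eq le[OF k(1) r] r by (simp add: ennreal_leI)
      qed
    next
      \<comment> \<open>This covers the points outside the interval and also its left endpoint
        \<open>s 0\<close>, which belongs to no half-open partition interval; the left-hand side is
        0 there.\<close>
      case False
      then have "(\<Sum>i<n. ennreal (q i) * indicator {s i<..s (Suc i)} r) = 0"
        by (intro sum.neutral) (auto simp: indicator_def)
      then show ?thesis
        by simp
    qed
  qed
  finally show ?thesis .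
qed

text \<open>Where \<open>J k\<close> is within distance \<open>1\<close> of the limit, the exponential changes by at most a factor
  \<open>e\<close>; elsewhere the truncated exponential is dominated by a multiple of the squared distance. This
  avoids passing to an almost surely convergent subsequence.\<close>

lemma nn_integral_exp_abs_L2_limit:
  fixes I :: "'a \<Rightarrow> real" and J :: "nat \<Rightarrow> 'a \<Rightarrow> real"
  assumes [measurable]: "I \<in> borel_measurable M" "\<And>k. J k \<in> borel_measurable M"
    and bound: "\<And>k. (\<integral>\<^sup>+\<omega>. ennreal (exp \<bar>J k \<omega>\<bar>) \<partial>M) \<le> C"
    and lim: "(\<lambda>k. \<integral>\<^sup>+\<omega>. ennreal ((J k \<omega> - I \<omega>)\<^sup>2) \<partial>M) \<longlonglongrightarrow> 0"
  shows "(\<integral>\<^sup>+\<omega>. ennreal (exp \<bar>I \<omega>\<bar>) \<partial>M) \<le> ennreal (exp 1) * C"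
proof -
  have trunc: "(\<integral>\<^sup>+\<omega>. min (ennreal (exp \<bar>I \<omega>\<bar>)) (of_nat N) \<partial>M) \<le> ennreal (exp 1) * C" for N
  proof -
    have "min (ennreal (exp \<bar>I \<omega>\<bar>)) (of_nat N)
        \<le> ennreal (exp 1) * ennreal (exp \<bar>J k \<omega>\<bar>) + of_nat N * ennreal ((J k \<omega> - I \<omega>)\<^sup>2)" for k \<omega>
    proof (cases "\<bar>J k \<omega> - I \<omega>\<bar> \<le> 1")
      case True
      then have "exp \<bar>I \<omega>\<bar> \<le> exp 1 * exp \<bar>J k \<omega>\<bar>"
        unfolding exp_add[symmetric] by simp
      then have "ennreal (exp \<bar>I \<omega>\<bar>) \<le> ennreal (exp 1) * ennreal (exp \<bar>J k \<omega>\<bar>)"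
        by (simp add: ennreal_mult[symmetric] ennreal_leI)
      then show ?thesis
        by (meson add_increasing2 min.coboundedI1 zero_le)
    next
      case False
      then have "1 \<le> (J k \<omega> - I \<omega>)\<^sup>2"
        using abs_le_square_iff[of 1 "J k \<omega> - I \<omega>"] by simp
      then have "of_nat N * 1 \<le> of_nat N * ennreal ((J k \<omega> - I \<omega>)\<^sup>2)"
        by (intro mult_left_mono) (simp_all flip: ennreal_1 add: ennreal_leI)
      then show ?thesis
        by (simp add: add_increasing min.coboundedI2)
    qed
    then have "(\<integral>\<^sup>+\<omega>. min (ennreal (exp \<bar>I \<omega>\<bar>)) (of_nat N) \<partial>M)
        \<le> (\<integral>\<^sup>+\<omega>. ennreal (exp 1) * ennreal (exp \<bar>J k \<omega>\<bar>) + of_nat N * ennreal ((J k \<omega> - I \<omega>)\<^sup>2) \<partial>M)" for k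
      by (intro nn_integral_mono)
    also have "\<dots> k = ennreal (exp 1) * (\<integral>\<^sup>+\<omega>. ennreal (exp \<bar>J k \<omega>\<bar>) \<partial>M)
        + of_nat N * (\<integral>\<^sup>+\<omega>. ennreal ((J k \<omega> - I \<omega>)\<^sup>2) \<partial>M)" for k
      by (subst nn_integral_add) (auto simp: nn_integral_cmult)
    also have "\<dots> k \<le> ennreal (exp 1) * C + of_nat N * (\<integral>\<^sup>+\<omega>. ennreal ((J k \<omega> - I \<omega>)\<^sup>2) \<partial>M)" for k
      by (intro add_right_mono mult_left_mono bound) simp
    finally have le: "(\<integral>\<^sup>+\<omega>. min (ennreal (exp \<bar>I \<omega>\<bar>)) (of_nat N) \<partial>M)
        \<le> ennreal (exp 1) * C + of_nat N * (\<integral>\<^sup>+\<omega>. ennreal ((J k \<omega> - I \<omega>)\<^sup>2) \<partial>M)" for k .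
    \<comment> \<open>The truncated integral does not depend on \<open>k\<close>, so letting
      \<open>k\<close> tend to infinity at fixed \<open>N\<close> removes the term carrying the
      factor \<open>N\<close>. Only afterwards is the truncation lifted by monotone convergence in
      \<open>N\<close>.\<close>
    have "(\<lambda>k. ennreal (exp 1) * C + of_nat N * (\<integral>\<^sup>+\<omega>. ennreal ((J k \<omega> - I \<omega>)\<^sup>2) \<partial>M))
        \<longlonglongrightarrow> ennreal (exp 1) * C + of_nat N * 0"
      by (intro tendsto_add tendsto_const ennreal_tendsto_cmult lim) (simp add: of_nat_less_top)
    then have "(\<integral>\<^sup>+\<omega>. min (ennreal (exp \<bar>I \<omega>\<bar>)) (of_nat N) \<partial>M) \<le> ennreal (exp 1) * C + of_nat N * 0"
      by (rule LIMSEQ_le_const) (use le in auto)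
    then show ?thesis
      by simp
  qed
  have sup: "ennreal (exp \<bar>I \<omega>\<bar>) = (SUP N. min (ennreal (exp \<bar>I \<omega>\<bar>)) (of_nat N))" for \<omega>
  proof (rule antisym)
    obtain N :: nat where "exp \<bar>I \<omega>\<bar> \<le> real N"
      using real_arch_simple by blast
    then have "ennreal (exp \<bar>I \<omega>\<bar>) \<le> of_nat N"
      by (simp add: ennreal_of_nat_eq_real_of_nat ennreal_leI)
    then show "ennreal (exp \<bar>I \<omega>\<bar>) \<le> (SUP N. min (ennreal (exp \<bar>I \<omega>\<bar>)) (of_nat N))"
      by (intro SUP_upper2[of N]) auto
  qed (auto intro: SUP_least)
  have "(\<integral>\<^sup>+\<omega>. ennreal (exp \<bar>I \<omega>\<bar>) \<partial>M) = (SUP N. \<integral>\<^sup>+\<omega>. min (ennreal (exp \<bar>I \<omega>\<bar>)) (of_nat N) \<partial>M)"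
    by (subst sup, rule nn_integral_monotone_convergence_SUP)
      (auto simp: incseq_def le_fun_def intro: min.coboundedI2 order_trans[OF _ of_nat_mono])
  also have "\<dots> \<le> ennreal (exp 1) * C"
    by (intro SUP_least trunc)
  finally show ?thesis .
qed

lemma exp_abs_le: "exp \<bar>x\<bar> \<le> exp x + exp (- x)" for x :: real
  by (cases "0 \<le> x") auto

text \<open>The approximating simple integrands need not be uniformly bounded. Projecting their values to
  the ball of radius \<open>K\<close>, which contains the values of \<open>H\<close>, moves them by at most their distance
  from \<open>H\<close>, so the integrals of the projected integrands have the same limit. Integrals with respect
  to \<open>W\<close> are written as integrals with respect to \<open>(W, B)\<close> of integrands with last component \<open>0\<close>.\<close>

lemma nn_integral_exp_abs_ito:
  fixes W :: "real \<Rightarrow> 'w \<Rightarrow> real ^ 'n" and B :: "real \<Rightarrow> 'w \<Rightarrow> real"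
    and H :: "real \<Rightarrow> 'w \<Rightarrow> real ^ 'n ^ 'm"
  assumes Z: "wiener_space M F (\<lambda>t \<omega>. (W t \<omega>, B t \<omega>))"
    and I: "has_ito_integral M F W a b H I" and a: "0 \<le> a" and K: "0 \<le> K"
    and H: "\<And>r \<omega>. r \<in> {a..b} \<Longrightarrow> \<omega> \<in> space M \<Longrightarrow> norm (H r \<omega>) \<le> K"
  shows "(\<integral>\<^sup>+\<omega>. ennreal (exp \<bar>I \<omega> $ j\<bar>) \<partial>M) \<le> ennreal (exp 1 * (2 * exp (K\<^sup>2 * (b - a) / 2)))"
proof -
  interpret wiener_space M F "\<lambda>t \<omega>. (W t \<omega>, B t \<omega>)"
    by (rule Z)
  let ?\<pi> = "closest_point (cball (0 :: real ^ 'n ^ 'm) K)"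
  let ?c = "ennreal (DIM((real ^ 'n) \<times> real))"
  obtain n s \<xi> where simple: "\<And>k. simple_integrand F a b (n k) (s k) (\<xi> k)"
    and limH: "(\<lambda>k. \<integral>\<^sup>+\<omega>. (\<integral>\<^sup>+r\<in>{a..b}. ennreal ((norm (simple_process (n k) (s k) (\<xi> k) r \<omega> - H r \<omega>))\<^sup>2)
               \<partial>lborel) \<partial>M) \<longlonglongrightarrow> 0"
    and limI: "(\<lambda>k. \<integral>\<^sup>+\<omega>. ennreal ((norm (simple_ito W (n k) (s k) (\<xi> k) \<omega> - I \<omega>))\<^sup>2) \<partial>M) \<longlonglongrightarrow> 0"
    and IM: "I \<in> borel_measurable M"
    using I unfolding has_ito_integral_def by blast
  have s0: "s k 0 = a" and sn: "s k (n k) = b" and step: "i < n k \<Longrightarrow> s k i < s k (Suc i)"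
    and \<xi>: "i < n k \<Longrightarrow> \<xi> k i \<in> borel_measurable (F (s k i))" for k i
    using simple[of k] unfolding simple_integrand_def by auto
  have s_nonneg: "0 \<le> s k i" if "i \<le> n k" for k i
    using partition_mono[of "n k" "s k" 0 i, OF step] s0[of k] a that by auto
  define dW where "dW k i \<omega> = (W (s k (Suc i)) \<omega>, B (s k (Suc i)) \<omega>) - (W (s k i) \<omega>, B (s k i) \<omega>)" for k i \<omega>
  \<comment> \<open>Component \<open>j\<close> of a matrix applied to an increment is the inner
    product with row \<open>j\<close>. Thus \<open>J\<close> integrates row \<open>j\<close> of the
    projected coefficient and \<open>R\<close> integrates row \<open>j\<close> of the projection
    error, and \<open>J - R\<close> is component \<open>j\<close> of the original simple
    integral.\<close>
  define u where "u k i \<omega> = (?\<pi> (\<xi> k i \<omega>) $ j, 0 :: real)" for k i \<omega>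
  define w where "w k i \<omega> = ((?\<pi> (\<xi> k i \<omega>) - \<xi> k i \<omega>) $ j, 0 :: real)" for k i \<omega>
  define J where "J k \<omega> = (\<Sum>i<n k. u k i \<omega> \<bullet> dW k i \<omega>)" for k \<omega>
  define R where "R k \<omega> = (\<Sum>i<n k. w k i \<omega> \<bullet> dW k i \<omega>)" for k \<omega>
  have \<pi>: "?\<pi> \<in> borel_measurable borel"
    by (intro borel_measurable_continuous_onI continuous_on_closest_point) (use K in auto)
  have proj: "(\<lambda>A :: real ^ 'n ^ 'm. (A $ j, 0 :: real)) \<in> borel_measurable borel"
    by (intro borel_measurable_continuous_onI continuous_intros)
  have u: "u k i \<in> borel_measurable (F (s k i))" and w: "w k i \<in> borel_measurable (F (s k i))"
    if "i < n k" for k i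
    unfolding u_def w_def
    by (rule measurable_compose[OF measurable_compose[OF \<xi>[OF that] \<pi>] proj],
        rule measurable_compose[OF borel_measurable_diff[OF
          measurable_compose[OF \<xi>[OF that] \<pi>] \<xi>[OF that]] proj])
  have uK: "norm (u k i \<omega>) \<le> K" for k i \<omega>
  proof -
    have "norm (?\<pi> (\<xi> k i \<omega>)) \<le> K"
      using closest_point_in_set[of "cball (0 :: real ^ 'n ^ 'm) K" "\<xi> k i \<omega>"] K by auto
    then show ?thesis
      unfolding u_def norm_Pair using Finite_Cartesian_Product.norm_nth_le[of "?\<pi> (\<xi> k i \<omega>)" j] by simp
  qed
  have expJ: "J k \<in> borel_measurable (F b) \<and>
      (\<integral>\<^sup>+\<omega>. ennreal (exp (J k \<omega>)) \<partial>M) \<le> ennreal (exp (K\<^sup>2 * (b - a) / 2))" for k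
    using nn_integral_exp_simple_sum[of "s k" "n k" "u k" K] step u uK a
    unfolding J_def dW_def s0 sn by simp
  \<comment> \<open>Changing the sign of the coefficients preserves their norm bound, so both tails
    obey the same estimate; together they control the exponential of the absolute value and account
    for the factor 2.\<close>
  have expJ': "(\<integral>\<^sup>+\<omega>. ennreal (exp (- J k \<omega>)) \<partial>M) \<le> ennreal (exp (K\<^sup>2 * (b - a) / 2))" for k
    using nn_integral_exp_simple_sum[of "s k" "n k" "\<lambda>i \<omega>. - u k i \<omega>" K] step u uK a
    unfolding J_def dW_def s0 sn by (simp add: sum_negf)
  have b: "0 \<le> b"
    using s_nonneg[of "n 0" 0] sn by simp
  have JM[measurable]: "J k \<in> borel_measurable M" for k
    using expJ measurable_from_subalg[OF subalgebra_F[OF b]] by blast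
  have bound: "(\<integral>\<^sup>+\<omega>. ennreal (exp \<bar>J k \<omega>\<bar>) \<partial>M) \<le> ennreal (2 * exp (K\<^sup>2 * (b - a) / 2))" for k
  proof -
    have "(\<integral>\<^sup>+\<omega>. ennreal (exp \<bar>J k \<omega>\<bar>) \<partial>M) \<le> (\<integral>\<^sup>+\<omega>. ennreal (exp (J k \<omega>)) + ennreal (exp (- J k \<omega>)) \<partial>M)"
      using exp_abs_le by (intro nn_integral_mono) (simp add: ennreal_leI flip: ennreal_plus)
    also have "\<dots> = (\<integral>\<^sup>+\<omega>. ennreal (exp (J k \<omega>)) \<partial>M) + (\<integral>\<^sup>+\<omega>. ennreal (exp (- J k \<omega>)) \<partial>M)"
      by (rule nn_integral_add) auto
    also have "\<dots> \<le> ennreal (exp (K\<^sup>2 * (b - a) / 2)) + ennreal (exp (K\<^sup>2 * (b - a) / 2))"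
      using expJ[of k] expJ'[of k] by (intro add_mono) auto
    finally show ?thesis
      by (simp flip: ennreal_plus)
  qed
  let ?D = "\<lambda>k \<omega>. \<integral>\<^sup>+r\<in>{a..b}. ennreal ((norm (simple_process (n k) (s k) (\<xi> k) r \<omega> - H r \<omega>))\<^sup>2) \<partial>lborel"
  have R: "R k \<in> borel_measurable (F b) \<and> (\<integral>\<^sup>+\<omega>. ennreal ((R k \<omega>)\<^sup>2) \<partial>M) \<le> ?c * (\<integral>\<^sup>+\<omega>. ?D k \<omega> \<partial>M)" for k
  proof -
    have wM: "w k i \<in> borel_measurable M" if "i < n k" for i
      by (rule measurable_from_subalg[OF subalgebra_F[OF s_nonneg[OF less_imp_le[OF that]]] w[OF that]])
    have simple_sum: "R k \<in> borel_measurable (F b) \<and> (\<integral>\<^sup>+\<omega>. ennreal ((R k \<omega>)\<^sup>2) \<partial>M)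
        \<le> (\<Sum>i<n k. ennreal (DIM((real ^ 'n) \<times> real) * (s k (Suc i) - s k i))
            * (\<integral>\<^sup>+\<omega>. ennreal ((norm (w k i \<omega>))\<^sup>2) \<partial>M))"
      using nn_integral_square_simple_sum[of "s k" "n k" "w k"] step w a
      unfolding R_def dW_def s0 sn by simp
    have "(\<Sum>i<n k. ennreal (DIM((real ^ 'n) \<times> real) * (s k (Suc i) - s k i))
            * (\<integral>\<^sup>+\<omega>. ennreal ((norm (w k i \<omega>))\<^sup>2) \<partial>M))
        = (\<Sum>i<n k. ?c * (\<integral>\<^sup>+\<omega>. ennreal (s k (Suc i) - s k i) * ennreal ((norm (w k i \<omega>))\<^sup>2) \<partial>M))"
    proof (intro sum.cong refl)
      fix i assume "i \<in> {..<n k}"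
      then have "w k i \<in> borel_measurable M" "0 \<le> s k (Suc i) - s k i"
        using wM step[of i k] by auto
      then show "ennreal (DIM((real ^ 'n) \<times> real) * (s k (Suc i) - s k i)) * (\<integral>\<^sup>+\<omega>. ennreal ((norm (w k i \<omega>))\<^sup>2) \<partial>M)
          = ?c * (\<integral>\<^sup>+\<omega>. ennreal (s k (Suc i) - s k i) * ennreal ((norm (w k i \<omega>))\<^sup>2) \<partial>M)"
        by (subst nn_integral_cmult) (auto simp: ennreal_mult mult.assoc)
    qed
    also have "\<dots> = ?c * (\<integral>\<^sup>+\<omega>. (\<Sum>i<n k. ennreal (s k (Suc i) - s k i) * ennreal ((norm (w k i \<omega>))\<^sup>2)) \<partial>M)"
      using wM by (subst nn_integral_sum) (auto simp: sum_distrib_left)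
    also have "(\<integral>\<^sup>+\<omega>. (\<Sum>i<n k. ennreal (s k (Suc i) - s k i) * ennreal ((norm (w k i \<omega>))\<^sup>2)) \<partial>M)
        \<le> (\<integral>\<^sup>+\<omega>. ?D k \<omega> \<partial>M)"
    proof (rule nn_integral_mono)
      fix \<omega> assume \<omega>: "\<omega> \<in> space M"
      have "(norm (w k i \<omega>))\<^sup>2 \<le> (norm (\<xi> k i \<omega> - H r \<omega>))\<^sup>2" if r: "r \<in> {s k 0..s k (n k)}" for i r
      proof (rule power_mono)
        have "norm (w k i \<omega>) \<le> norm (?\<pi> (\<xi> k i \<omega>) - \<xi> k i \<omega>)"
          unfolding w_def norm_Pair using Finite_Cartesian_Product.norm_nth_le[of "?\<pi> (\<xi> k i \<omega>) - \<xi> k i \<omega>" j] by simp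
        also have "\<dots> = dist (\<xi> k i \<omega>) (?\<pi> (\<xi> k i \<omega>))"
          by (simp add: dist_norm norm_minus_commute)
        also have "\<dots> \<le> dist (\<xi> k i \<omega>) (H r \<omega>)"
          using H[OF _ \<omega>, of r] r unfolding s0 sn by (intro closest_point_le) auto
        finally show "norm (w k i \<omega>) \<le> norm (\<xi> k i \<omega> - H r \<omega>)"
          by (simp add: dist_norm)
      qed simp
      then show "(\<Sum>i<n k. ennreal (s k (Suc i) - s k i) * ennreal ((norm (w k i \<omega>))\<^sup>2)) \<le> ?D k \<omega>"
        using simple_sum_le_process_distance[of "n k" "s k" "\<lambda>i. (norm (w k i \<omega>))\<^sup>2" "\<xi> k" \<omega> H, OF step]
        unfolding s0 sn by simp
    qed
    finally have "(\<Sum>i<n k. ennreal (DIM((real ^ 'n) \<times> real) * (s k (Suc i) - s k i))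
        * (\<integral>\<^sup>+\<omega>. ennreal ((norm (w k i \<omega>))\<^sup>2) \<partial>M)) \<le> ?c * (\<integral>\<^sup>+\<omega>. ?D k \<omega> \<partial>M)"
      by (simp add: mult_left_mono)
    then show ?thesis
      using simple_sum order_trans by blast
  qed
  have RM[measurable]: "R k \<in> borel_measurable M" for k
    using R measurable_from_subalg[OF subalgebra_F[OF b]] by blast
  have IjM[measurable]: "(\<lambda>\<omega>. I \<omega> $ j) \<in> borel_measurable M"
    by (rule measurable_compose[OF IM]) (intro borel_measurable_continuous_onI continuous_intros)
  have ito_component: "simple_ito W (n k) (s k) (\<xi> k) \<omega> $ j = J k \<omega> - R k \<omega>" for k \<omega>
    unfolding simple_ito_def J_def R_def u_def w_def dW_def sum_subtractf[symmetric]
    by (simp add: matrix_vector_mul_component inner_diff_left)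
  have J_lim: "(\<lambda>k. \<integral>\<^sup>+\<omega>. ennreal ((J k \<omega> - I \<omega> $ j)\<^sup>2) \<partial>M) \<longlonglongrightarrow> 0"
  proof (rule tendsto_sandwich[where f = "\<lambda>_. 0"])
    let ?E = "\<lambda>k. \<integral>\<^sup>+\<omega>. ennreal ((norm (simple_ito W (n k) (s k) (\<xi> k) \<omega> - I \<omega>))\<^sup>2) \<partial>M"
    show "\<forall>\<^sub>F k in sequentially. (\<integral>\<^sup>+\<omega>. ennreal ((J k \<omega> - I \<omega> $ j)\<^sup>2) \<partial>M)
        \<le> 2 * (?c * (\<integral>\<^sup>+\<omega>. ?D k \<omega> \<partial>M)) + 2 * ?E k"
    proof (rule always_eventually, rule allI)
      fix k
      let ?v = "\<lambda>\<omega>. J k \<omega> - R k \<omega> - I \<omega> $ j"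
      \<comment> \<open>The error splits as
        \<open>J k \<omega> - I \<omega> $ j = R k \<omega> + ?v \<omega>\<close>: the effect of the
        projection, controlled by the distance of the integrands, and the error of the given
        approximating integrals.\<close>
      have sq: "(J k \<omega> - I \<omega> $ j)\<^sup>2 \<le> 2 * (R k \<omega>)\<^sup>2 + 2 * (?v \<omega>)\<^sup>2" for \<omega>
        using zero_le_power2[of "R k \<omega> - ?v \<omega>"] by (simp add: power2_eq_square algebra_simps)
      have v: "(?v \<omega>)\<^sup>2 \<le> (norm (simple_ito W (n k) (s k) (\<xi> k) \<omega> - I \<omega>))\<^sup>2" for \<omega>
        using Finite_Cartesian_Product.norm_nth_le[of "simple_ito W (n k) (s k) (\<xi> k) \<omega> - I \<omega>" j] ito_component[of k \<omega>]
          power_mono[of "\<bar>?v \<omega>\<bar>" _ 2] by simp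
      have "(\<integral>\<^sup>+\<omega>. ennreal ((J k \<omega> - I \<omega> $ j)\<^sup>2) \<partial>M)
          \<le> (\<integral>\<^sup>+\<omega>. 2 * ennreal ((R k \<omega>)\<^sup>2) + 2 * ennreal ((?v \<omega>)\<^sup>2) \<partial>M)"
      proof (rule nn_integral_mono)
        fix \<omega>
        have "ennreal ((J k \<omega> - I \<omega> $ j)\<^sup>2) \<le> ennreal (2 * (R k \<omega>)\<^sup>2 + 2 * (?v \<omega>)\<^sup>2)"
          by (rule ennreal_leI[OF sq])
        then show "ennreal ((J k \<omega> - I \<omega> $ j)\<^sup>2) \<le> 2 * ennreal ((R k \<omega>)\<^sup>2) + 2 * ennreal ((?v \<omega>)\<^sup>2)"
          by (simp add: ennreal_plus ennreal_mult)
      qed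
      also have "\<dots> = 2 * (\<integral>\<^sup>+\<omega>. ennreal ((R k \<omega>)\<^sup>2) \<partial>M) + 2 * (\<integral>\<^sup>+\<omega>. ennreal ((?v \<omega>)\<^sup>2) \<partial>M)"
        by (subst nn_integral_add) (auto simp: nn_integral_cmult)
      also have "\<dots> \<le> 2 * (?c * (\<integral>\<^sup>+\<omega>. ?D k \<omega> \<partial>M)) + 2 * ?E k"
        using R[of k] by (intro add_mono mult_left_mono nn_integral_mono ennreal_leI v) auto
      finally show "(\<integral>\<^sup>+\<omega>. ennreal ((J k \<omega> - I \<omega> $ j)\<^sup>2) \<partial>M) \<le> 2 * (?c * (\<integral>\<^sup>+\<omega>. ?D k \<omega> \<partial>M)) + 2 * ?E k" .
    qed
    have "(\<lambda>k. 2 * (?c * (\<integral>\<^sup>+\<omega>. ?D k \<omega> \<partial>M)) + 2 * ?E k) \<longlonglongrightarrow> 2 * (?c * 0) + 2 * 0"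
      by (intro tendsto_add ennreal_tendsto_cmult limH limI) auto
    then show "(\<lambda>k. 2 * (?c * (\<integral>\<^sup>+\<omega>. ?D k \<omega> \<partial>M)) + 2 * ?E k) \<longlonglongrightarrow> 0"
      by simp
  qed auto
  show ?thesis
    using nn_integral_exp_abs_L2_limit[OF IjM JM bound J_lim] by (simp add: ennreal_mult)
qed

section \<open>Moments of the controlled processes\<close>

lemma progressively_measurable_on_section:
  assumes "progressively_measurable_on S F Z" "t \<in> S"
  shows "Z t \<in> borel_measurable (F t)"
proof -
  have section_meas: "Pair t \<in> measurable (F t) (restrict_space borel (S \<inter> {..t}) \<Otimes>\<^sub>M F t)"
    using assms(2) by (intro measurable_Pair1') (simp add: space_restrict_space)
  have "(\<lambda>(s, \<omega>). Z s \<omega>) \<in> borel_measurable (restrict_space borel (S \<inter> {..t}) \<Otimes>\<^sub>M F t)"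
    using assms unfolding progressively_measurable_on_def by blast
  from measurable_compose[OF section_meas this] show ?thesis
    by simp
qed

text \<open>A non-integrable \<open>g\<close> has integral 0 by convention, which also respects the
  bound, since \<open>K\<close> is nonnegative. Drift and running cost can therefore be bounded path
  by path from pointwise bounds alone.\<close>

lemma norm_set_integral_lborel_le:
  fixes g :: "real \<Rightarrow> 'b::{banach, second_countable_topology}"
  assumes "a \<le> b" and "\<And>s. s \<in> {a..b} \<Longrightarrow> norm (g s) \<le> K"
  shows "norm (LBINT s:{a..b}. g s) \<le> K * (b - a)"
proof -
  have K: "0 \<le> K"
    using order_trans[OF norm_ge_zero assms(2)[of a]] assms(1) by simp
  have "norm (LBINT s:{a..b}. g s) \<le> (\<integral>s. norm (indicator {a..b} s *\<^sub>R g s) \<partial>lborel)"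
    unfolding set_lebesgue_integral_def by (rule integral_norm_bound)
  also have "\<dots> \<le> (\<integral>s. indicator {a..b} s * K \<partial>lborel)"
  proof (rule integral_mono')
    show "integrable lborel (\<lambda>s. indicator {a..b} s * K)"
      using assms(1) by (intro integrable_mult_left integrable_real_indicator) auto
  qed (use assms(2) K in \<open>auto simp: indicator_def\<close>)
  also have "\<dots> = K * (b - a)"
    using assms(1) by simp
  finally show ?thesis .
qed

text \<open>Up to the factorial, the power is a single term of the exponential series, whose terms
  are all nonnegative.\<close>

lemma power_le_fact_mult_exp:
  fixes x :: real
  assumes "0 \<le> x"
  shows "x ^ q \<le> fact q * exp x"
proof -
  have "(\<Sum>n\<in>{q}. inverse (fact n) * x ^ n) \<le> (\<Sum>n. inverse (fact n) * x ^ n)"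
    using assms by (intro sum_le_suminf summable_exp) auto
  then show ?thesis
    by (simp add: exp_def field_simps)
qed

text \<open>Since the norm is at most the sum of the absolute components, some component must carry
  at least its average share. Dividing by the dimension thus yields a sum of exponentials of single
  components instead of their product, so exponential moments of the separate components
  suffice.\<close>

lemma exp_norm_le_sum_components:
  fixes v w :: "real ^ 'd"
  assumes "norm v \<le> c + norm w" "0 \<le> c"
  shows "exp (norm v / CARD('d)) \<le> exp c * (\<Sum>j\<in>UNIV. exp \<bar>w $ j\<bar>)"
proof -
  have "\<exists>j. norm v / CARD('d) \<le> c + \<bar>w $ j\<bar>"
  proof (rule ccontr)
    assume "\<nexists>j. norm v / CARD('d) \<le> c + \<bar>w $ j\<bar>"
    then have "(\<Sum>j\<in>(UNIV :: 'd set). c + \<bar>w $ j\<bar>) < (\<Sum>j\<in>(UNIV :: 'd set). norm v / CARD('d))"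
      by (intro sum_strict_mono) (auto simp: not_le)
    then have "CARD('d) * c + (\<Sum>j\<in>UNIV. \<bar>w $ j\<bar>) < norm v"
      by (simp add: sum.distrib)
    moreover have "1 * c \<le> CARD('d) * c"
      using assms(2) by (intro mult_right_mono) (simp_all add: Suc_leI)
    ultimately show False
      using assms(1) norm_le_l1_cart[of w] by simp
  qed
  then obtain j where "norm v / CARD('d) \<le> c + \<bar>w $ j\<bar>"
    by blast
  then have "exp (norm v / CARD('d)) \<le> exp c * exp \<bar>w $ j\<bar>"
    by (simp flip: exp_add)
  also have "\<dots> \<le> exp c * (\<Sum>j\<in>UNIV. exp \<bar>w $ j\<bar>)"
    by (intro mult_left_mono member_le_sum) auto
  finally show ?thesis .
qed

text \<open>The drift moves the state by at most \<open>K * (T - t0)\<close> on every relevant path,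
  and the stochastic part is estimated component by component. The right-hand side is free of
  \<alpha>, which is the source of all later uniformity over strategies.\<close>

lemma nn_integral_exp_state:
  fixes W :: "real \<Rightarrow> 'w \<Rightarrow> real ^ 'd" and B :: "real \<Rightarrow> 'w \<Rightarrow> real"
  assumes Z: "wiener_space M F (\<lambda>t \<omega>. (W t \<omega>, B t \<omega>))"
    and \<alpha>: "\<alpha> \<in> strategies M F T A" and t0: "t0 \<in> {0..T}"
    and X: "solves_state M F W b \<sigma> t0 T x \<alpha> X" and K: "0 \<le> K"
    and bound: "\<And>a t x. a \<in> A \<Longrightarrow> t \<in> {0..T} \<Longrightarrow> norm (\<sigma> a t x) \<le> K \<and> norm (b a t x) \<le> K"
  shows "(\<integral>\<^sup>+\<omega>. ennreal (exp (norm (X T \<omega>) / CARD('d))) \<partial>M)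
    \<le> ennreal (exp (norm x + K * (T - t0)) * (CARD('d) * (exp 1 * (2 * exp (K\<^sup>2 * (T - t0) / 2)))))"
proof -
  let ?c = "norm x + K * (T - t0)" and ?C = "exp 1 * (2 * exp (K\<^sup>2 * (T - t0) / 2))"
  obtain I where I: "has_ito_integral M F W t0 T (\<lambda>s \<omega>. \<sigma> (\<alpha> s \<omega>) s (X s \<omega>)) (I T)"
    and eq: "AE \<omega> in M. X T \<omega> = x + (LBINT s:{t0..T}. b (\<alpha> s \<omega>) s (X s \<omega>)) + I T \<omega>"
  proof -
    obtain I where "\<forall>t\<in>{t0..T}. has_ito_integral M F W t0 t (\<lambda>s \<omega>. \<sigma> (\<alpha> s \<omega>) s (X s \<omega>)) (I t)"
      and "AE \<omega> in M. \<forall>t\<in>{t0..T}. X t \<omega> = x + (LBINT s:{t0..t}. b (\<alpha> s \<omega>) s (X s \<omega>)) + I t \<omega>"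
      using X unfolding solves_state_def by blast
    moreover have "T \<in> {t0..T}"
      using t0 by simp
    ultimately show ?thesis
      by (intro that[of I]) (auto elim: eventually_mono)
  qed
  have \<alpha>A: "\<alpha> s \<omega> \<in> A" if "s \<in> {t0..T}" "\<omega> \<in> space M" for s \<omega>
    using \<alpha> t0 that unfolding strategies_def by auto
  have IM[measurable]: "I T \<in> borel_measurable M"
    using I unfolding has_ito_integral_def by blast
  have IjM[measurable]: "(\<lambda>\<omega>. I T \<omega> $ j) \<in> borel_measurable M" for j
    by (rule measurable_compose[OF IM]) (intro borel_measurable_continuous_onI continuous_intros)
  have "(\<integral>\<^sup>+\<omega>. ennreal (exp (norm (X T \<omega>) / CARD('d))) \<partial>M)
      \<le> (\<integral>\<^sup>+\<omega>. ennreal (exp ?c) * (\<Sum>j\<in>UNIV. ennreal (exp \<bar>I T \<omega> $ j\<bar>)) \<partial>M)"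
  proof (rule nn_integral_mono_AE, use eq AE_space in eventually_elim)
    fix \<omega> assume X: "X T \<omega> = x + (LBINT s:{t0..T}. b (\<alpha> s \<omega>) s (X s \<omega>)) + I T \<omega>"
      and \<omega>: "\<omega> \<in> space M"
    have "norm (LBINT s:{t0..T}. b (\<alpha> s \<omega>) s (X s \<omega>)) \<le> K * (T - t0)"
      using t0 bound[OF \<alpha>A[OF _ \<omega>]] by (intro norm_set_integral_lborel_le) auto
    then have "norm (X T \<omega>) \<le> ?c + norm (I T \<omega>)"
      unfolding X by (intro order_trans[OF norm_triangle_ineq] add_mono) auto
    then have "exp (norm (X T \<omega>) / CARD('d)) \<le> exp ?c * (\<Sum>j\<in>UNIV. exp \<bar>I T \<omega> $ j\<bar>)"
      using K t0 by (intro exp_norm_le_sum_components) auto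
    then show "ennreal (exp (norm (X T \<omega>) / CARD('d))) \<le> ennreal (exp ?c) * (\<Sum>j\<in>UNIV. ennreal (exp \<bar>I T \<omega> $ j\<bar>))"
      by (simp add: ennreal_mult[symmetric] sum_nonneg ennreal_leI)
  qed
  also have "\<dots> = ennreal (exp ?c) * (\<Sum>j\<in>UNIV. \<integral>\<^sup>+\<omega>. ennreal (exp \<bar>I T \<omega> $ j\<bar>) \<partial>M)"
    by (subst nn_integral_cmult) (simp_all add: nn_integral_sum del: sum_ennreal)
  also have "\<dots> \<le> ennreal (exp ?c) * (\<Sum>j\<in>(UNIV :: 'd set). ennreal ?C)"
    using t0 bound[OF \<alpha>A]
    by (intro mult_left_mono sum_mono nn_integral_exp_abs_ito[OF Z I _ K]) auto
  also have "\<dots> = ennreal (exp ?c * (CARD('d) * ?C))"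
    by (simp add: ennreal_mult ennreal_of_nat_eq_real_of_nat)
  finally show ?thesis .
qed

text \<open>The inequality (a + b)^2 <= 2 a^2 + 2 b^2 is applied twice, to the cost plus \<Phi> and
  to the growth bound \<open>1 + norm x ^ m\<close>; this produces the coefficients 2 and 4. The
  remaining power \<open>2 * m\<close> of the norm is absorbed by the exponential moment.\<close>

lemma (in prob_space) terminal_gain_second_moment:
  fixes X :: "'a \<Rightarrow> real ^ 'd"
  assumes X[measurable]: "X \<in> borel_measurable M" and Y[measurable]: "Y \<in> borel_measurable M"
    and \<Phi>: "continuous_on UNIV \<Phi>" and growth: "\<And>x. \<bar>\<Phi> x\<bar> \<le> k * (1 + norm x ^ m)"
    and Yb: "AE \<omega> in M. \<bar>Y \<omega>\<bar> \<le> L" and R: "0 \<le> R"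
    and exp_moment: "(\<integral>\<^sup>+\<omega>. ennreal (exp (norm (X \<omega>) / CARD('d))) \<partial>M) \<le> ennreal R"
  shows "(\<lambda>\<omega>. terminal_gain \<Phi> (X \<omega>) (Y \<omega>)) \<in> borel_measurable M"
    and "integrable M (\<lambda>\<omega>. (terminal_gain \<Phi> (X \<omega>) (Y \<omega>))\<^sup>2)"
    and "expectation (\<lambda>\<omega>. (terminal_gain \<Phi> (X \<omega>) (Y \<omega>))\<^sup>2)
      \<le> 2 * L\<^sup>2 + 4 * k\<^sup>2 + 4 * k\<^sup>2 * (CARD('d) ^ (2 * m) * fact (2 * m)) * R"
proof -
  let ?e = "\<lambda>\<omega>. exp (norm (X \<omega>) / CARD('d))"
  let ?c = "2 * L\<^sup>2 + 4 * k\<^sup>2" and ?k = "4 * k\<^sup>2 * (CARD('d) ^ (2 * m) * fact (2 * m))"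
  have [measurable]: "\<Phi> \<in> borel_measurable borel"
    using \<Phi> by (rule borel_measurable_continuous_onI)
  show meas[measurable]: "(\<lambda>\<omega>. terminal_gain \<Phi> (X \<omega>) (Y \<omega>)) \<in> borel_measurable M"
    unfolding terminal_gain_def by measurable
  have int_e: "integrable M ?e"
    using exp_moment by (intro integrableI_bounded) (auto simp: le_less_trans[OF _ ennreal_less_top])
  have E_e: "expectation ?e \<le> R"
    by (rule integral_real_bounded[OF R exp_moment])
  have int_bound: "integrable M (\<lambda>\<omega>. ?c + ?k * ?e \<omega>)"
    using int_e by simp
  have le: "AE \<omega> in M. (terminal_gain \<Phi> (X \<omega>) (Y \<omega>))\<^sup>2 \<le> ?c + ?k * ?e \<omega>"
    using Yb
  proof eventually_elim
    case (elim \<omega>)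
    let ?z = "norm (X \<omega>)"
    have sum_sq: "(a + b)\<^sup>2 \<le> 2 * a\<^sup>2 + 2 * b\<^sup>2" for a b :: real
      using zero_le_power2[of "a - b"] by (simp add: power2_eq_square algebra_simps)
    \<comment> \<open>The norm is rescaled by the dimension to match the exponent for which the
      moment bound is available.\<close>
    have "?z ^ (2 * m) = CARD('d) ^ (2 * m) * (?z / CARD('d)) ^ (2 * m)"
      by (simp add: power_divide)
    also have "\<dots> \<le> CARD('d) ^ (2 * m) * (fact (2 * m) * ?e \<omega>)"
      by (intro mult_left_mono power_le_fact_mult_exp) auto
    finally have z: "?z ^ (2 * m) \<le> CARD('d) ^ (2 * m) * (fact (2 * m) * ?e \<omega>)" .
    have "(\<Phi> (X \<omega>))\<^sup>2 \<le> (k * (1 + ?z ^ m))\<^sup>2"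
      using power_mono[OF growth[of "X \<omega>"], of 2] by simp
    also have "\<dots> = k\<^sup>2 * (1 + ?z ^ m)\<^sup>2"
      by (rule power_mult_distrib)
    also have "\<dots> \<le> k\<^sup>2 * (2 * 1\<^sup>2 + 2 * (?z ^ m)\<^sup>2)"
      by (intro mult_left_mono sum_sq) simp
    also have "\<dots> \<le> k\<^sup>2 * (2 + 2 * (CARD('d) ^ (2 * m) * (fact (2 * m) * ?e \<omega>)))"
      using z by (intro mult_left_mono) (auto simp: power_mult[symmetric] mult.commute)
    finally have \<Phi>2: "(\<Phi> (X \<omega>))\<^sup>2 \<le> k\<^sup>2 * (2 + 2 * (CARD('d) ^ (2 * m) * (fact (2 * m) * ?e \<omega>)))" .
    have "(terminal_gain \<Phi> (X \<omega>) (Y \<omega>))\<^sup>2 \<le> 2 * (Y \<omega>)\<^sup>2 + 2 * (\<Phi> (X \<omega>))\<^sup>2"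
      unfolding terminal_gain_def by (rule sum_sq)
    moreover have "(Y \<omega>)\<^sup>2 \<le> L\<^sup>2"
      using power_mono[OF elim, of 2] by simp
    ultimately show ?case
      using \<Phi>2 by (simp add: algebra_simps)
  qed
  show int: "integrable M (\<lambda>\<omega>. (terminal_gain \<Phi> (X \<omega>) (Y \<omega>))\<^sup>2)"
    by (rule Bochner_Integration.integrable_bound[OF int_bound]) (use le in auto)
  have "expectation (\<lambda>\<omega>. (terminal_gain \<Phi> (X \<omega>) (Y \<omega>))\<^sup>2) \<le> expectation (\<lambda>\<omega>. ?c + ?k * ?e \<omega>)"
    by (rule integral_mono_AE[OF int int_bound le])
  also have "\<dots> = ?c + ?k * expectation ?e"
    using int_e by (simp add: prob_space)
  also have "\<dots> \<le> ?c + ?k * R"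
    using E_e by (intro add_left_mono mult_left_mono) auto
  finally show "expectation (\<lambda>\<omega>. (terminal_gain \<Phi> (X \<omega>) (Y \<omega>))\<^sup>2) \<le> ?c + ?k * R" .
qed

section \<open>Perturbation of mean-variance functionals\<close>

text \<open>The mean is controlled through |g| <= 1 + g^2, and the variance is at most the second
  moment. With a uniform \<open>C\<close> this makes the functional bounded over all
  strategies.\<close>

lemma (in prob_space) abs_mean_variance_le:
  fixes G :: "'a \<Rightarrow> real"
  assumes [measurable]: "G \<in> borel_measurable M" and G2: "integrable M (\<lambda>\<omega>. (G \<omega>)\<^sup>2)"
    and C: "expectation (\<lambda>\<omega>. (G \<omega>)\<^sup>2) \<le> C"
  shows "\<bar>expectation G - \<theta> * variance G\<bar> \<le> 1 + C + \<bar>\<theta>\<bar> * C"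
proof -
  have G: "integrable M G"
    by (rule square_integrable_imp_integrable[OF _ G2]) simp
  have "\<bar>expectation G\<bar> \<le> expectation (\<lambda>\<omega>. \<bar>G \<omega>\<bar>)"
    by (rule integral_abs_bound)
  also have "\<dots> \<le> expectation (\<lambda>\<omega>. 1 + (G \<omega>)\<^sup>2)"
  proof (rule integral_mono)
    fix \<omega>
    show "\<bar>G \<omega>\<bar> \<le> 1 + (G \<omega>)\<^sup>2"
      using zero_le_power2[of "\<bar>G \<omega>\<bar> - 1"] abs_ge_zero[of "G \<omega>"]
      by (simp add: power2_eq_square algebra_simps)
  qed (use G G2 in auto)
  also have "\<dots> \<le> 1 + C"
    using G2 C by (simp add: prob_space)
  finally have "\<bar>expectation G\<bar> \<le> 1 + C" .
  moreover have "\<bar>variance G\<bar> \<le> C"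
    using variance_positive[of G] variance_eq[OF G G2] C zero_le_power2[of "expectation G"]
    by linarith
  then have "\<bar>\<theta> * variance G\<bar> \<le> \<bar>\<theta>\<bar> * C"
    unfolding abs_mult by (intro mult_left_mono) auto
  ultimately show ?thesis
    by linarith
qed

text \<open>As \<open>N\<close> is centred, its covariance with \<open>G\<close> is the expectation
  of \<open>G \<omega> * N \<omega>\<close>, and |G N| <= (G^2 + N^2) / 2 bounds the mixed term by
  \<open>\<epsilon> * (C + D)\<close>. The relation between \<open>G'\<close> and \<open>G\<close>
  is almost sure because the cost equations hold only up to null sets.\<close>

lemma (in prob_space) mean_variance_perturbation:
  fixes G G' N :: "'a \<Rightarrow> real"
  assumes [measurable]: "G \<in> borel_measurable M" "N \<in> borel_measurable M" "G' \<in> borel_measurable M"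
    and G2: "integrable M (\<lambda>\<omega>. (G \<omega>)\<^sup>2)" and N2: "integrable M (\<lambda>\<omega>. (N \<omega>)\<^sup>2)"
    and N: "expectation N = 0" and G': "AE \<omega> in M. G' \<omega> = G \<omega> + \<epsilon> * N \<omega>" and \<epsilon>: "0 \<le> \<epsilon>"
    and C: "expectation (\<lambda>\<omega>. (G \<omega>)\<^sup>2) \<le> C" and D: "expectation (\<lambda>\<omega>. (N \<omega>)\<^sup>2) \<le> D"
  shows "\<bar>(expectation G' - \<theta> * variance G') - (expectation G - \<theta> * variance G)\<bar>
    \<le> \<bar>\<theta>\<bar> * (\<epsilon> * (C + D) + \<epsilon>\<^sup>2 * D)"
proof -
  let ?H = "\<lambda>\<omega>. G \<omega> + \<epsilon> * N \<omega>"
  have G1: "integrable M G" and N1: "integrable M N"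
    by (rule square_integrable_imp_integrable[OF _ G2] square_integrable_imp_integrable[OF _ N2], simp)+
  have le: "\<bar>G \<omega> * N \<omega>\<bar> \<le> ((G \<omega>)\<^sup>2 + (N \<omega>)\<^sup>2) / 2" for \<omega>
    using zero_le_power2[of "\<bar>G \<omega>\<bar> - \<bar>N \<omega>\<bar>"] by (simp add: power2_diff abs_mult)
  have GN: "integrable M (\<lambda>\<omega>. G \<omega> * N \<omega>)"
    by (rule Bochner_Integration.integrable_bound[where f = "\<lambda>\<omega>. ((G \<omega>)\<^sup>2 + (N \<omega>)\<^sup>2) / 2"])
      (use G2 N2 le in \<open>auto intro: order_trans\<close>)
  have "\<bar>expectation (\<lambda>\<omega>. G \<omega> * N \<omega>)\<bar> \<le> expectation (\<lambda>\<omega>. \<bar>G \<omega> * N \<omega>\<bar>)"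
    by (rule integral_abs_bound)
  also have "\<dots> \<le> expectation (\<lambda>\<omega>. ((G \<omega>)\<^sup>2 + (N \<omega>)\<^sup>2) / 2)"
    using GN G2 N2 le by (intro integral_mono) auto
  also have "\<dots> \<le> (C + D) / 2"
    using G2 N2 C D by simp
  finally have cov: "\<bar>expectation (\<lambda>\<omega>. G \<omega> * N \<omega>)\<bar> \<le> (C + D) / 2" .
  have H2_eq: "(?H \<omega>)\<^sup>2 = (G \<omega>)\<^sup>2 + 2 * \<epsilon> * (G \<omega> * N \<omega>) + \<epsilon>\<^sup>2 * (N \<omega>)\<^sup>2" for \<omega>
    by (simp add: power2_eq_square algebra_simps)
  have H2: "integrable M (\<lambda>\<omega>. (?H \<omega>)\<^sup>2)"
    unfolding H2_eq using G2 N2 GN by auto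
  have H1: "integrable M ?H"
    using G1 N1 by simp
  have EH: "expectation ?H = expectation G"
    using G1 N1 N by simp
  have "expectation (\<lambda>\<omega>. (?H \<omega>)\<^sup>2)
      = expectation (\<lambda>\<omega>. (G \<omega>)\<^sup>2) + 2 * \<epsilon> * expectation (\<lambda>\<omega>. G \<omega> * N \<omega>) + \<epsilon>\<^sup>2 * expectation (\<lambda>\<omega>. (N \<omega>)\<^sup>2)"
    unfolding H2_eq using G2 N2 GN by simp
  then have var: "variance ?H - variance G = 2 * \<epsilon> * expectation (\<lambda>\<omega>. G \<omega> * N \<omega>) + \<epsilon>\<^sup>2 * expectation (\<lambda>\<omega>. (N \<omega>)\<^sup>2)"
    using variance_eq[OF H1 H2] variance_eq[OF G1 G2] arg_cong[OF EH, of power2] by linarith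
  have E': "expectation G' = expectation ?H"
    by (rule integral_cong_AE) (use G' in auto)
  have "variance G' = variance ?H"
    unfolding E' by (rule integral_cong_AE) (use G' in auto)
  then have "\<bar>(expectation G' - \<theta> * variance G') - (expectation G - \<theta> * variance G)\<bar>
      = \<bar>\<theta>\<bar> * \<bar>2 * \<epsilon> * expectation (\<lambda>\<omega>. G \<omega> * N \<omega>) + \<epsilon>\<^sup>2 * expectation (\<lambda>\<omega>. (N \<omega>)\<^sup>2)\<bar>"
    unfolding var[symmetric] E' EH abs_mult[symmetric] by (simp add: right_diff_distrib)
  also have "\<dots> \<le> \<bar>\<theta>\<bar> * (\<epsilon> * (C + D) + \<epsilon>\<^sup>2 * D)"
  proof (rule mult_left_mono)
    have "\<bar>2 * \<epsilon> * expectation (\<lambda>\<omega>. G \<omega> * N \<omega>)\<bar> \<le> 2 * \<epsilon> * ((C + D) / 2)"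
      unfolding abs_mult[of "2 * \<epsilon>"] using cov \<epsilon> by (intro mult_mono) auto
    moreover have "\<epsilon>\<^sup>2 * expectation (\<lambda>\<omega>. (N \<omega>)\<^sup>2) \<le> \<epsilon>\<^sup>2 * D" "0 \<le> \<epsilon>\<^sup>2 * expectation (\<lambda>\<omega>. (N \<omega>)\<^sup>2)"
      using D by (auto intro!: mult_left_mono mult_nonneg_nonneg)
    ultimately show "\<bar>2 * \<epsilon> * expectation (\<lambda>\<omega>. G \<omega> * N \<omega>) + \<epsilon>\<^sup>2 * expectation (\<lambda>\<omega>. (N \<omega>)\<^sup>2)\<bar>
        \<le> \<epsilon> * (C + D) + \<epsilon>\<^sup>2 * D"
      by linarith
  qed simp
  finally show ?thesis .
qed

section \<open>Suprema and nearly optimal elements under uniform perturbation\<close>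

lemma bdd_above_image_abs_le:
  fixes J :: "'s \<Rightarrow> real"
  assumes "\<And>\<alpha>. \<alpha> \<in> S \<Longrightarrow> \<bar>J \<alpha>\<bar> \<le> c"
  shows "bdd_above (J ` S)"
  by (rule bdd_aboveI[of _ c]) (use assms in force)

text \<open>The distance \<open>r\<close> is spent twice: once in passing from the supremum of
  \<open>J\<close> to that of \<open>J'\<close>, and once in returning from
  \<open>J' \<alpha>\<close> to \<open>J \<alpha>\<close>. Boundedness of \<open>J\<close> carries
  over to \<open>J'\<close> and makes the supremum of \<open>J'\<close> a genuine upper
  bound.\<close>

lemma nearly_optimal_perturbation:
  assumes J: "\<And>\<alpha>. \<alpha> \<in> S \<Longrightarrow> \<bar>J \<alpha>\<bar> \<le> c" and J': "\<And>\<alpha>. \<alpha> \<in> S \<Longrightarrow> \<bar>J' \<alpha> - J \<alpha>\<bar> \<le> r"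
    and opt: "nearly_optimal \<kappa> S J' \<alpha>"
  shows "nearly_optimal (\<kappa> + 2 * r) S J \<alpha>"
proof -
  have \<alpha>: "\<alpha> \<in> S" and le: "value_of S J' \<le> J' \<alpha> + \<kappa>"
    using opt unfolding nearly_optimal_def by auto
  have bdd: "bdd_above (J' ` S)"
    by (rule bdd_above_image_abs_le[of _ _ "c + r"]) (use J J' in force)
  have "value_of S J \<le> value_of S J' + r"
    unfolding value_of_def
  proof (rule cSUP_least)
    fix \<beta> assume \<beta>: "\<beta> \<in> S"
    show "J \<beta> \<le> (SUP \<alpha>\<in>S. J' \<alpha>) + r"
      using cSUP_upper[OF \<beta> bdd] J'[OF \<beta>] by linarith
  qed (use \<alpha> in auto)
  then show ?thesis
    using le J'[OF \<alpha>] \<alpha> unfolding nearly_optimal_def by linarith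
qed

lemma nearly_optimal_exists:
  assumes "S \<noteq> {}" "bdd_above (J ` S)" "0 < \<kappa>"
  shows "\<exists>\<alpha>. nearly_optimal \<kappa> S J \<alpha>"
proof -
  have "value_of S J - \<kappa> < (SUP \<alpha>\<in>S. J \<alpha>)"
    using assms(3) by (simp add: value_of_def)
  then obtain \<alpha> where "\<alpha> \<in> S" "value_of S J - \<kappa> < J \<alpha>"
    using less_cSUP_iff[OF assms(1,2)] by blast
  then show ?thesis
    unfolding nearly_optimal_def by (intro exI[of _ \<alpha>]) simp
qed

lemma strategies_nonempty:
  assumes "A \<noteq> {}"
  shows "strategies M F T A \<noteq> {}"
proof -
  obtain a where "a \<in> A"
    using assms by blast
  then have "(\<lambda>_ _. a) \<in> strategies M F T A"
    by (simp add: strategies_def progressively_measurable_on_def)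
  then show ?thesis
    by blast
qed

text \<open>The order of quantifiers is the point: \<open>C\<close> is obtained before the strategy,
  the processes and \<epsilon>, so both estimates are uniform in all of them.\<close>

lemma mv_functional_estimates:
  fixes M :: "'w measure" and F :: "real \<Rightarrow> 'w measure"
    and W :: "real \<Rightarrow> 'w \<Rightarrow> real ^ 'd" and B :: "real \<Rightarrow> 'w \<Rightarrow> real"
    and A :: "(real ^ 'l) set" and T \<theta> t0 y :: real and x :: "real ^ 'd"
  assumes "filtered_prob_space M F"
    and "wiener_process M F (\<lambda>t \<omega>. (W t \<omega>, B t \<omega>))"
    and A0: "conditions_A0 A T b \<sigma> f \<Phi>" and t0: "t0 \<in> {0..T}" and A: "A \<noteq> {}"
  obtains C where "0 \<le> C"
    and "\<And>\<alpha> X Y. \<alpha> \<in> strategies M F T A \<Longrightarrow> solves_state M F W b \<sigma> t0 T x \<alpha> (X \<alpha>) \<Longrightarrow>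
      solves_cost M F B f t0 T y 0 \<alpha> (X \<alpha>) (Y \<alpha>) \<Longrightarrow>
      \<bar>mv_functional M \<theta> \<Phi> T X Y \<alpha>\<bar> \<le> 1 + C + \<bar>\<theta>\<bar> * C"
    and "\<And>\<alpha> X Y Y' \<epsilon>. \<alpha> \<in> strategies M F T A \<Longrightarrow> solves_state M F W b \<sigma> t0 T x \<alpha> (X \<alpha>) \<Longrightarrow>
      solves_cost M F B f t0 T y 0 \<alpha> (X \<alpha>) (Y \<alpha>) \<Longrightarrow>
      solves_cost M F B f t0 T y \<epsilon> \<alpha> (X \<alpha>) (Y' \<alpha>) \<Longrightarrow> 0 \<le> \<epsilon> \<Longrightarrow>
      \<bar>mv_functional M \<theta> \<Phi> T X Y' \<alpha> - mv_functional M \<theta> \<Phi> T X Y \<alpha>\<bar>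
        \<le> \<bar>\<theta>\<bar> * (\<epsilon> * (C + (T - t0)) + \<epsilon>\<^sup>2 * (T - t0))"
proof -
  have Z: "wiener_space M F (\<lambda>t \<omega>. (W t \<omega>, B t \<omega>))"
    using assms(1,2) by (intro wiener_space.intro wiener_space_axioms.intro)
  interpret wiener_space M F "\<lambda>t \<omega>. (W t \<omega>, B t \<omega>)"
    by (rule Z)
  obtain K k m where
    K: "\<And>a t x. a \<in> A \<Longrightarrow> t \<in> {0..T} \<Longrightarrow> norm (\<sigma> a t x) + norm (b a t x) \<le> K \<and> \<bar>f a t x\<bar> \<le> k"
    and growth: "\<And>x. \<bar>\<Phi> x\<bar> \<le> k * (1 + norm x ^ m)"
    using A0 unfolding conditions_A0_def by metis
  have \<Phi>: "continuous_on UNIV \<Phi>"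
    using A0 unfolding conditions_A0_def by blast
  have bound: "norm (\<sigma> a t x) \<le> K \<and> norm (b a t x) \<le> K" if "a \<in> A" "t \<in> {0..T}" for a t x
    using K[OF that, of x] norm_ge_zero[of "\<sigma> a t x"] norm_ge_zero[of "b a t x"] by linarith
  have K0: "0 \<le> K"
    using A t0 bound[of _ t0] norm_ge_zero order_trans by blast
  \<comment> \<open>\<open>L\<close> bounds the noiseless terminal cost almost surely,
    \<open>R\<close> is the exponential moment bound of the state, and \<open>C\<close> the
    resulting second-moment bound for the terminal gain.\<close>
  define L where "L = \<bar>y\<bar> + k * (T - t0)"
  define R where "R = exp (norm x + K * (T - t0)) * (CARD('d) * (exp 1 * (2 * exp (K\<^sup>2 * (T - t0) / 2))))"
  define C where "C = 2 * L\<^sup>2 + 4 * k\<^sup>2 + 4 * k\<^sup>2 * (CARD('d) ^ (2 * m) * fact (2 * m)) * R"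
  have R0: "0 \<le> R"
    by (simp add: R_def)
  have C0: "0 \<le> C"
    using R0 by (simp add: C_def)
  have T0: "0 \<le> T" and TT: "T \<in> {t0..T}"
    using t0 by auto
  have X_meas: "X T \<in> borel_measurable M" if "solves_state M F W b \<sigma> t0 T x \<alpha> X" for \<alpha> X
    using that progressively_measurable_on_section[OF _ TT] measurable_from_subalg[OF subalgebra_F[OF T0]]
    unfolding solves_state_def by blast
  have Y_meas: "Y T \<in> borel_measurable M" if "solves_cost M F B f t0 T y \<epsilon> \<alpha> X Y" for \<epsilon> \<alpha> X Y
    using that progressively_measurable_on_section[OF _ TT] measurable_from_subalg[OF subalgebra_F[OF T0]]
    unfolding solves_cost_def by blast
  have Y_eq: "AE \<omega> in M. Y T \<omega> = y + (LBINT s:{t0..T}. f (\<alpha> s \<omega>) s (X s \<omega>)) + \<epsilon> * (B T \<omega> - B t0 \<omega>)"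
    if "solves_cost M F B f t0 T y \<epsilon> \<alpha> X Y" for \<epsilon> \<alpha> X Y
    using that TT unfolding solves_cost_def by fastforce
  have Y_bound: "AE \<omega> in M. \<bar>Y T \<omega>\<bar> \<le> L"
    if \<alpha>: "\<alpha> \<in> strategies M F T A" and Y: "solves_cost M F B f t0 T y 0 \<alpha> X Y" for \<alpha> X Y
    using Y_eq[OF Y] AE_space
  proof eventually_elim
    case (elim \<omega>)
    have "\<alpha> s \<omega> \<in> A" if "s \<in> {t0..T}" for s
      using \<alpha> t0 that elim(2) unfolding strategies_def by auto
    then have "norm (LBINT s:{t0..T}. f (\<alpha> s \<omega>) s (X s \<omega>)) \<le> k * (T - t0)"
      using t0 K by (intro norm_set_integral_lborel_le) auto
    then show ?case
      using elim(1) unfolding L_def by simp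
  qed
  have G: "(\<lambda>\<omega>. terminal_gain \<Phi> (X T \<omega>) (Y T \<omega>)) \<in> borel_measurable M"
      "integrable M (\<lambda>\<omega>. (terminal_gain \<Phi> (X T \<omega>) (Y T \<omega>))\<^sup>2)"
      "expectation (\<lambda>\<omega>. (terminal_gain \<Phi> (X T \<omega>) (Y T \<omega>))\<^sup>2) \<le> C"
    if \<alpha>: "\<alpha> \<in> strategies M F T A" and X: "solves_state M F W b \<sigma> t0 T x \<alpha> X"
      and Y: "solves_cost M F B f t0 T y 0 \<alpha> X Y" for \<alpha> X Y
    using terminal_gain_second_moment[OF X_meas[OF X] Y_meas[OF Y] \<Phi> growth Y_bound[OF \<alpha> Y] R0]
      nn_integral_exp_state[OF Z \<alpha> t0 X K0 bound]
    unfolding C_def R_def by blast+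
  \<comment> \<open>The inner product with this basis vector extracts the \<open>B\<close> component
    of the joint Wiener process.\<close>
  have 01: "(0 :: real ^ 'd, 1 :: real) \<in> Basis"
    by (simp add: Basis_prod_def)
  have BM: "(\<lambda>\<omega>. B T \<omega> - B t0 \<omega>) \<in> borel_measurable M"
    and B: "expectation (\<lambda>\<omega>. B T \<omega> - B t0 \<omega>) = 0" "integrable M (\<lambda>\<omega>. (B T \<omega> - B t0 \<omega>)\<^sup>2)"
      "expectation (\<lambda>\<omega>. (B T \<omega> - B t0 \<omega>)\<^sup>2) \<le> T - t0"
    using increment_moments[OF _ _ 01, of t0 T] t0 by (auto dest: borel_measurable_integrable)
  show ?thesis
  proof (rule that[OF C0])
    fix \<alpha> X Y
    assume "\<alpha> \<in> strategies M F T A" "solves_state M F W b \<sigma> t0 T x \<alpha> (X \<alpha>)"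
      and "solves_cost M F B f t0 T y 0 \<alpha> (X \<alpha>) (Y \<alpha>)"
    note G = G[OF this]
    show "\<bar>mv_functional M \<theta> \<Phi> T X Y \<alpha>\<bar> \<le> 1 + C + \<bar>\<theta>\<bar> * C"
      unfolding mv_functional_def by (rule abs_mean_variance_le[OF G])
  next
    fix \<alpha> X Y Y' \<epsilon>
    assume \<alpha>: "\<alpha> \<in> strategies M F T A" and X: "solves_state M F W b \<sigma> t0 T x \<alpha> (X \<alpha>)"
      and Y: "solves_cost M F B f t0 T y 0 \<alpha> (X \<alpha>) (Y \<alpha>)"
      and Y': "solves_cost M F B f t0 T y \<epsilon> \<alpha> (X \<alpha>) (Y' \<alpha>)" and \<epsilon>: "0 \<le> \<epsilon>"
    note G = G[OF \<alpha> X Y]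
    \<comment> \<open>Both costs are driven by the same control and state, so their drift integrals
      agree and only the noise remains.\<close>
    have "AE \<omega> in M. terminal_gain \<Phi> (X \<alpha> T \<omega>) (Y' \<alpha> T \<omega>)
        = terminal_gain \<Phi> (X \<alpha> T \<omega>) (Y \<alpha> T \<omega>) + \<epsilon> * (B T \<omega> - B t0 \<omega>)"
      using Y_eq[OF Y] Y_eq[OF Y'] by eventually_elim (simp add: terminal_gain_def)
    moreover have "(\<lambda>\<omega>. terminal_gain \<Phi> (X \<alpha> T \<omega>) (Y' \<alpha> T \<omega>)) \<in> borel_measurable M"
      unfolding terminal_gain_def
      by (intro borel_measurable_add Y_meas[OF Y']
          measurable_compose[OF X_meas[OF X] borel_measurable_continuous_onI[OF \<Phi>]])
    ultimately show "\<bar>mv_functional M \<theta> \<Phi> T X Y' \<alpha> - mv_functional M \<theta> \<Phi> T X Y \<alpha>\<bar>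
        \<le> \<bar>\<theta>\<bar> * (\<epsilon> * (C + (T - t0)) + \<epsilon>\<^sup>2 * (T - t0))"
      unfolding mv_functional_def
      by (intro mean_variance_perturbation[OF G(1) BM _ G(2) B(2,1) _ \<epsilon> G(3) B(3)])
  qed
qed

section \<open>Transfer of optimality to the degenerate problem\<close>

theorem theorem5p3:
  fixes M :: "'w measure" and F :: "real \<Rightarrow> 'w measure"
    and W :: "real \<Rightarrow> 'w \<Rightarrow> real ^ 'd" and B :: "real \<Rightarrow> 'w \<Rightarrow> real"
    and A :: "(real ^ 'l) set" and T \<theta> t0 y :: real and x :: "real ^ 'd"
    and b :: "real ^ 'l \<Rightarrow> real \<Rightarrow> real ^ 'd \<Rightarrow> real ^ 'd"
    and \<sigma> :: "real ^ 'l \<Rightarrow> real \<Rightarrow> real ^ 'd \<Rightarrow> real ^ 'd ^ 'd"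
    and f :: "real ^ 'l \<Rightarrow> real \<Rightarrow> real ^ 'd \<Rightarrow> real"
    and \<Phi> :: "real ^ 'd \<Rightarrow> real"
    and X :: "(real \<Rightarrow> 'w \<Rightarrow> real ^ 'l) \<Rightarrow> real \<Rightarrow> 'w \<Rightarrow> real ^ 'd"
    and Y :: "(real \<Rightarrow> 'w \<Rightarrow> real ^ 'l) \<Rightarrow> real \<Rightarrow> 'w \<Rightarrow> real"
    and Y\<epsilon> :: "real \<Rightarrow> (real \<Rightarrow> 'w \<Rightarrow> real ^ 'l) \<Rightarrow> real \<Rightarrow> 'w \<Rightarrow> real"
  assumes "filtered_prob_space M F"
    and "wiener_process M F (\<lambda>t \<omega>. (W t \<omega>, B t \<omega>))"
    and "T > 0" and "compact A" and "convex A" and "A \<noteq> {}"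
    and "conditions_A0 A T b \<sigma> f \<Phi>"
    and "t0 \<in> {0..T}"
    and "\<And>\<alpha>. \<alpha> \<in> strategies M F T A \<Longrightarrow> solves_state M F W b \<sigma> t0 T x \<alpha> (X \<alpha>)"
    and "\<And>\<alpha>. \<alpha> \<in> strategies M F T A \<Longrightarrow> solves_cost M F B f t0 T y 0 \<alpha> (X \<alpha>) (Y \<alpha>)"
    and "\<And>\<alpha> \<epsilon>. \<alpha> \<in> strategies M F T A \<Longrightarrow> \<epsilon> > 0 \<Longrightarrow>
           solves_cost M F B f t0 T y \<epsilon> \<alpha> (X \<alpha>) (Y\<epsilon> \<epsilon> \<alpha>)"
  shows "let S = strategies M F T A;
             v = mv_functional M \<theta> \<Phi> T X Y;
             v\<epsilon> = (\<lambda>\<epsilon>. mv_functional M \<theta> \<Phi> T X (Y\<epsilon> \<epsilon>))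
         in \<exists>\<delta> :: real \<Rightarrow> real \<Rightarrow> real.
              ((\<lambda>(\<epsilon>, \<kappa>). \<delta> \<epsilon> \<kappa>) \<longlongrightarrow> 0) (at (0, 0) within {0<..} \<times> {0..}) \<and>
              (\<forall>\<epsilon>>0. \<forall>\<alpha>. optimal S (v\<epsilon> \<epsilon>) \<alpha> \<longrightarrow> nearly_optimal (\<delta> \<epsilon> 0) S v \<alpha>) \<and>
              (\<forall>\<epsilon>>0. \<forall>\<kappa>>0. \<forall>\<alpha>. nearly_optimal \<kappa> S (v\<epsilon> \<epsilon>) \<alpha> \<longrightarrow>
                                   nearly_optimal (\<delta> \<epsilon> \<kappa>) S v \<alpha>) \<and>
              (\<forall>\<eta>>0. \<exists>\<epsilon>>0. \<exists>\<kappa>>0. \<delta> \<epsilon> \<kappa> \<le> \<eta> \<and>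
                 (\<exists>\<alpha>. nearly_optimal \<kappa> S (v\<epsilon> \<epsilon>) \<alpha> \<and> nearly_optimal \<eta> S v \<alpha>))"
proof -
  let ?S = "strategies M F T A" and ?v = "mv_functional M \<theta> \<Phi> T X Y"
    and ?v\<epsilon> = "\<lambda>\<epsilon>. mv_functional M \<theta> \<Phi> T X (Y\<epsilon> \<epsilon>)"
  obtain C where C: "0 \<le> C"
    and bounded: "\<And>\<alpha> X Y. \<alpha> \<in> ?S \<Longrightarrow> solves_state M F W b \<sigma> t0 T x \<alpha> (X \<alpha>) \<Longrightarrow>
      solves_cost M F B f t0 T y 0 \<alpha> (X \<alpha>) (Y \<alpha>) \<Longrightarrow>
      \<bar>mv_functional M \<theta> \<Phi> T X Y \<alpha>\<bar> \<le> 1 + C + \<bar>\<theta>\<bar> * C"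
    and close: "\<And>\<alpha> X Y Y' \<epsilon>. \<alpha> \<in> ?S \<Longrightarrow> solves_state M F W b \<sigma> t0 T x \<alpha> (X \<alpha>) \<Longrightarrow>
      solves_cost M F B f t0 T y 0 \<alpha> (X \<alpha>) (Y \<alpha>) \<Longrightarrow>
      solves_cost M F B f t0 T y \<epsilon> \<alpha> (X \<alpha>) (Y' \<alpha>) \<Longrightarrow> 0 \<le> \<epsilon> \<Longrightarrow>
      \<bar>mv_functional M \<theta> \<Phi> T X Y' \<alpha> - mv_functional M \<theta> \<Phi> T X Y \<alpha>\<bar>
        \<le> \<bar>\<theta>\<bar> * (\<epsilon> * (C + (T - t0)) + \<epsilon>\<^sup>2 * (T - t0))"
    by (rule mv_functional_estimates[OF assms(1,2,7,8,6), of x y \<theta>]) blast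
  define r where "r \<epsilon> = \<bar>\<theta>\<bar> * (\<epsilon> * (C + (T - t0)) + \<epsilon>\<^sup>2 * (T - t0))" for \<epsilon>
  define \<delta> where "\<delta> \<epsilon> \<kappa> = \<kappa> + 2 * r \<epsilon>" for \<epsilon> \<kappa>
  have v: "\<bar>?v \<alpha>\<bar> \<le> 1 + C + \<bar>\<theta>\<bar> * C" if "\<alpha> \<in> ?S" for \<alpha>
    using that assms(9,10) by (intro bounded)
  have v\<epsilon>: "\<bar>?v\<epsilon> \<epsilon> \<alpha> - ?v \<alpha>\<bar> \<le> r \<epsilon>" if "\<alpha> \<in> ?S" "0 < \<epsilon>" for \<alpha> \<epsilon>
    unfolding r_def using that assms(9-11) by (intro close) auto
  have transfer: "nearly_optimal (\<delta> \<epsilon> \<kappa>) ?S ?v \<alpha>"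
    if "nearly_optimal \<kappa> ?S (?v\<epsilon> \<epsilon>) \<alpha>" "0 < \<epsilon>" for \<epsilon> \<kappa> \<alpha>
    unfolding \<delta>_def by (rule nearly_optimal_perturbation[OF v v\<epsilon> that(1)]) (use that(2) in auto)
  have lim: "((\<lambda>(\<epsilon>, \<kappa>). \<delta> \<epsilon> \<kappa>) \<longlongrightarrow> 0) (at (0, 0) within {0<..} \<times> {0..})"
    unfolding \<delta>_def r_def case_prod_unfold by (auto intro!: tendsto_eq_intros)
  \<comment> \<open>Optimality is near-optimality with \<kappa> = 0, a value that
    \<open>transfer\<close> covers.\<close>
  have exact: "nearly_optimal (\<delta> \<epsilon> 0) ?S ?v \<alpha>" if "optimal ?S (?v\<epsilon> \<epsilon>) \<alpha>" "0 < \<epsilon>" for \<epsilon> \<alpha>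
    using that by (intro transfer) (auto simp: optimal_def nearly_optimal_def)
  have small: "\<exists>\<epsilon>>0. \<exists>\<kappa>>0. \<delta> \<epsilon> \<kappa> \<le> \<eta> \<and> (\<exists>\<alpha>. nearly_optimal \<kappa> ?S (?v\<epsilon> \<epsilon>) \<alpha> \<and> nearly_optimal \<eta> ?S ?v \<alpha>)"
    if \<eta>: "0 < \<eta>" for \<eta>
  proof -
    \<comment> \<open>For \<epsilon> at most 1 the quadratic term of \<open>r\<close> is dominated
      by a linear one, which gives \<open>2 * r \<epsilon> \<le> c * \<epsilon>\<close>. Half of
      \<eta> is then reserved for this term and half for \<kappa>. The denominator uses
      \<open>c + 1\<close> because \<open>c\<close> vanishes when \<theta> = 0.\<close>
    define c where "c = 2 * \<bar>\<theta>\<bar> * (C + 2 * (T - t0))"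
    define \<epsilon> where "\<epsilon> = min 1 (\<eta> / (2 * (c + 1)))"
    have c: "0 \<le> c"
      using C assms(8) by (simp add: c_def)
    have \<epsilon>: "0 < \<epsilon>" "\<epsilon> \<le> 1" "\<epsilon> \<le> \<eta> / (2 * (c + 1))"
      using \<eta> c by (auto simp: \<epsilon>_def)
    have "2 * r \<epsilon> \<le> c * \<epsilon>"
    proof -
      have "\<epsilon>\<^sup>2 * (T - t0) \<le> \<epsilon> * (T - t0)"
        using \<epsilon> assms(8) by (intro mult_right_mono) (auto simp: power2_eq_square mult_left_le)
      then have "\<bar>\<theta>\<bar> * (\<epsilon> * (C + (T - t0)) + \<epsilon>\<^sup>2 * (T - t0)) \<le> \<bar>\<theta>\<bar> * (\<epsilon> * (C + 2 * (T - t0)))"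
        by (intro mult_left_mono) (auto simp: algebra_simps)
      then have "2 * r \<epsilon> \<le> 2 * (\<bar>\<theta>\<bar> * (\<epsilon> * (C + 2 * (T - t0))))"
        unfolding r_def by (rule mult_left_mono) simp
      also have "\<dots> = c * \<epsilon>"
        by (simp add: c_def)
      finally show ?thesis .
    qed
    also have "\<dots> \<le> (c + 1) * (\<eta> / (2 * (c + 1)))"
      using \<epsilon> c by (intro mult_mono) auto
    also have "\<dots> = \<eta> / 2"
      using c by (simp add: field_simps)
    finally have \<delta>: "\<delta> \<epsilon> (\<eta> / 2) \<le> \<eta>"
      by (simp add: \<delta>_def)
    \<comment> \<open>Boundedness of the regularised functional guarantees a nearly optimal strategy
      even if the supremum is not attained.\<close>
    have "bdd_above (?v\<epsilon> \<epsilon> ` ?S)"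
      by (rule bdd_above_image_abs_le[of _ _ "1 + C + \<bar>\<theta>\<bar> * C + r \<epsilon>"]) (use v v\<epsilon> \<epsilon>(1) in force)
    then obtain \<alpha> where \<alpha>: "nearly_optimal (\<eta> / 2) ?S (?v\<epsilon> \<epsilon>) \<alpha>"
      using nearly_optimal_exists[OF strategies_nonempty[OF assms(6)]] \<eta> by fastforce
    then have "nearly_optimal \<eta> ?S ?v \<alpha>"
      using transfer[OF \<alpha> \<epsilon>(1)] \<delta> unfolding nearly_optimal_def by linarith
    with \<alpha> \<delta> \<epsilon>(1) \<eta> show ?thesis
      by (intro exI[of _ \<epsilon>] conjI exI[of _ "\<eta> / 2"]) auto
  qed
  show ?thesis
    unfolding Let_def using lim exact transfer small by (intro exI[of _ \<delta>]) blast
qed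

end
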